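(* The function $\varphi(z) = z_1^3+z_2^3 + z_1z_2z_3$ is a Hilbert point in $H^2(\mathbb{T}^3)$ and in $H^4(\mathbb{T}^3)$, but it is not a Hilbert point in $H^p(\mathbb{T}^3)$ for any $4<p\leq \infty$.
   Context: $\mathbb{T}^3$ is the $3$-dimensional torus with normalized Haar measure $m_3$; $\widehat f(\alpha)=\int_{\mathbb{T}^3} f(z)\overline{z^\alpha}\,dm_3(z)$ for $\alpha\in\mathbb{Z}^3$. The Hardy space $H^p(\mathbb{T}^3)$ is the closed subspace of $L^p(\mathbb{T}^3)$ of functions $f$ with $\widehat f(\alpha)=0$ for all $\alpha\in\mathbb{Z}^3\setminus\mathbb{N}_0^3$, $\mathbb{N}_0=\{0,1,2,\ldots\}$, with the $L^p$ norm $\|\cdot\|_{H^p(\mathbb{T}^3)}$. Write $\langle f,g\rangle=\int_{\mathbb{T}^3} f\overline g\,dm_3$. For $2\le p\le\infty$, a nontrivial (i.e. not a.e. zero) function $\varphi$ in $H^p(\mathbb{T}^3)$ is a Hilbert point in $H^p(\mathbb{T}^3)$ if $\|\varphi\|_{H^p(\mathbb{T}^3)}\le\|\varphi+f\|_{H^p(\mathbb{T}^3)}$ for every $f\in H^p(\mathbb{T}^3)$ such that $\langle f,\varphi\rangle=0$. *)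

theory Defs
  imports "HOL-Probability.Essential_Supremum"
begin

definition circle_measure :: "complex measure" where
  "circle_measure =
     distr (uniform_measure lborel {0..2 * pi}) (restrict_space borel (sphere 0 1)) cis"

text \<open>The torus is the set of functions from the finite index type to the unit circle,
  with the product of the normalized arc length measures, i.e. its normalized Haar measure.\<close>

definition torus :: "('n::finite \<Rightarrow> complex) measure" where
  "torus = (\<Pi>\<^sub>M i\<in>UNIV. circle_measure)"

definition monomial :: "('n::finite \<Rightarrow> int) \<Rightarrow> ('n \<Rightarrow> complex) \<Rightarrow> complex" where
  "monomial \<alpha> z = (\<Prod>i\<in>UNIV. z i powi \<alpha> i)"

definition torus_inner ::
  "(('n::finite \<Rightarrow> complex) \<Rightarrow> complex) \<Rightarrow> (('n \<Rightarrow> complex) \<Rightarrow> complex) \<Rightarrow> complex" where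
  "torus_inner f g = (LINT z|torus. f z * cnj (g z))"

definition fourier_coeff ::
  "(('n::finite \<Rightarrow> complex) \<Rightarrow> complex) \<Rightarrow> ('n \<Rightarrow> int) \<Rightarrow> complex" where
  "fourier_coeff f \<alpha> = (LINT z|torus. f z * cnj (monomial \<alpha> z))"

text \<open>Functions are used in place of their almost everywhere equivalence classes. The exponent
  is meant to satisfy \<open>1 \<le> p \<le> \<infinity>\<close>. The norm is real-valued and has its intended value
  only on members of \<open>Lp p\<close>.\<close>

definition Lp :: "ennreal \<Rightarrow> (('n::finite \<Rightarrow> complex) \<Rightarrow> complex) set" where
  "Lp p = {f \<in> borel_measurable torus.
     if p = \<infinity> then esssup torus (\<lambda>z. ennreal (cmod (f z))) < \<infinity>
     else integrable torus (\<lambda>z. cmod (f z) powr enn2real p)}"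

definition Lp_norm :: "ennreal \<Rightarrow> (('n::finite \<Rightarrow> complex) \<Rightarrow> complex) \<Rightarrow> real" where
  "Lp_norm p f =
     (if p = \<infinity> then enn2real (esssup torus (\<lambda>z. ennreal (cmod (f z))))
      else (LINT z|torus. cmod (f z) powr enn2real p) powr (1 / enn2real p))"

definition Hardy :: "ennreal \<Rightarrow> (('n::finite \<Rightarrow> complex) \<Rightarrow> complex) set" where
  "Hardy p = {f \<in> Lp p. \<forall>\<alpha>. \<not> (\<forall>i. 0 \<le> \<alpha> i) \<longrightarrow> fourier_coeff f \<alpha> = 0}"

text \<open>Meant for \<open>2 \<le> p \<le> \<infinity>\<close>, where the inner product is defined on all of \<open>Hardy p\<close>.\<close>

definition hilbert_point ::
  "ennreal \<Rightarrow> (('n::finite \<Rightarrow> complex) \<Rightarrow> complex) \<Rightarrow> bool" where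
  "hilbert_point p \<phi> \<longleftrightarrow>
     \<phi> \<in> Hardy p \<and> \<not> (AE z in torus. \<phi> z = 0) \<and>
     (\<forall>f\<in>Hardy p. torus_inner f \<phi> = 0 \<longrightarrow> Lp_norm p \<phi> \<le> Lp_norm p (\<lambda>z. \<phi> z + f z))"

text \<open>The index type \<open>3\<close> has exactly the elements \<open>1\<close>, \<open>2\<close> and \<open>3\<close> (where \<open>3 = 0\<close>).\<close>

definition phi :: "(3 \<Rightarrow> complex) \<Rightarrow> complex" where
  "phi z = z 1 ^ 3 + z 2 ^ 3 + z 1 * z 2 * z 3"

end

theory Submission
  imports Defs "HOL-Probability.Probability"
begin

text \<open>
  Put \<open>a = z\<^sub>1\<^sup>3\<close>, \<open>b = z\<^sub>2\<^sup>3\<close>, \<open>c = z\<^sub>1z\<^sub>2z\<^sub>3\<close>, so that \<open>\<phi> = a + b + c\<close>. By convexity \<open>\<phi>\<close> is a Hilbert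
  point if \<open>\<bar>\<phi>\<bar>\<^sup>p\<^sup>-\<^sup>2\<phi>\<close> has the same pairing with \<open>H\<^sup>p\<close> as a multiple of \<open>\<phi>\<close>. For \<open>p = 2\<close> this is trivial, and for
  \<open>p = 4\<close> it holds because every monomial of \<open>\<bar>\<phi>\<bar>\<^sup>2\<phi> - 5\<phi>\<close> has a negative exponent.

  For \<open>p > 4\<close> the monomial \<open>z\<^sub>3\<^sup>3 = c\<^sup>3/(ab)\<close>, which is orthogonal to \<open>\<phi>\<close>, is a direction in which the norm decreases to
  first order. For finite \<open>p\<close> this means \<open>E[R\<^sup>\<beta> Re (\<phi> ab/c\<^sup>3)] > 0\<close> with \<open>R = \<bar>\<phi>\<bar>\<^sup>2\<close> and \<open>\<beta> = p/2 - 1 > 1\<close>. Integrating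
  by parts twice on the torus turns this expectation into \<open>\<beta>(\<beta> - 1) E[R\<^sup>\<beta>\<^sup>-\<^sup>2 T]\<close>, where \<open>T\<close> is a polynomial in \<open>R\<close> and
  \<open>X = Re (\<phi>\<^sup>3/(abc))\<close> that is nonnegative because of \<open>X\<^sup>2 \<le> R\<^sup>3\<close> and
  \<open>\<bar>(a - b)(b - c)(c - a)\<bar>\<^sup>2 = 27 - 18R - R\<^sup>2 + 8X\<close>. The singularity of \<open>R\<^sup>\<beta>\<^sup>-\<^sup>2\<close> at \<open>R = 0\<close> is avoided by first replacing
  \<open>R\<close> by \<open>R + \<epsilon>\<close>.
\<close>

section \<open>Rotation invariance of the torus\<close>

lemma emeasure_lborel_translation:
  fixes A :: "real set"
  assumes [measurable]: "A \<in> sets borel"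
  shows "emeasure lborel {t. c + t \<in> A} = emeasure lborel A"
proof -
  have "emeasure lborel A = emeasure (distr lborel borel ((+) c)) A"
    by (simp add: lborel_distr_plus)
  also have "\<dots> = emeasure lborel {t. c + t \<in> A}"
    by (subst emeasure_distr) (auto simp: vimage_def)
  finally show ?thesis by simp
qed

text \<open>The shifted window from \<open>s\<close> to \<open>s + p\<close> is cut at
  \<open>p\<close>, and the part beyond \<open>p\<close> is moved back by one period, where it fills
  the gap below \<open>s\<close>.\<close>

lemma emeasure_lborel_periodic:
  fixes D :: "real set"
  assumes [measurable]: "D \<in> sets borel" and per: "\<And>t. t + p \<in> D \<longleftrightarrow> t \<in> D"
    and s: "0 \<le> s" "s \<le> p"
  shows "emeasure lborel {t \<in> {0..p}. s + t \<in> D} = emeasure lborel (D \<inter> {0..p})"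
proof -
  \<comment> \<open>Discarding a single point makes the windows half-open, so that the pieces below
    are disjoint and fit together exactly.\<close>
  have null: "emeasure lborel (A \<inter> {u..v}) = emeasure lborel (A \<inter> {u..<v})"
    if [measurable]: "A \<in> sets borel" for A and u v :: real
  proof (rule emeasure_eq_AE)
    show "AE x in lborel. (x \<in> A \<inter> {u..v}) = (x \<in> A \<inter> {u..<v})"
      using AE_lborel_singleton[of v] by eventually_elim auto
  qed auto
  have "{t \<in> {0..p}. s + t \<in> D} = {t. s + t \<in> D \<inter> {s..s+p}}"
    by auto
  then have "emeasure lborel {t \<in> {0..p}. s + t \<in> D} = emeasure lborel (D \<inter> {s..s+p})"
    using emeasure_lborel_translation[of "D \<inter> {s..s+p}" s] by simp
  also have "\<dots> = emeasure lborel (D \<inter> {s..<s+p})"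
    by (rule null) simp
  also have "D \<inter> {s..<s+p} = (D \<inter> {s..<p}) \<union> (D \<inter> {p..<s+p})"
    using s by auto
  also have "emeasure lborel \<dots> = emeasure lborel (D \<inter> {s..<p}) + emeasure lborel (D \<inter> {p..<s+p})"
    by (rule plus_emeasure[symmetric]) auto
  also have "emeasure lborel (D \<inter> {p..<s+p}) = emeasure lborel {t. p + t \<in> D \<inter> {p..<s+p}}"
    by (rule emeasure_lborel_translation[symmetric]) auto
  also have "{t. p + t \<in> D \<inter> {p..<s+p}} = D \<inter> {0..<s}"
    using per by (auto simp: add.commute)
  also have "emeasure lborel (D \<inter> {s..<p}) + emeasure lborel (D \<inter> {0..<s}) =
      emeasure lborel (D \<inter> {s..<p} \<union> D \<inter> {0..<s})"
    by (rule plus_emeasure) auto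
  also have "D \<inter> {s..<p} \<union> D \<inter> {0..<s} = D \<inter> {0..<p}"
    using s by auto
  also have "emeasure lborel (D \<inter> {0..<p}) = emeasure lborel (D \<inter> {0..p})"
    by (rule null[symmetric]) simp
  finally show ?thesis .
qed

section \<open>Normalized arc length on the unit circle\<close>

lemma space_circle_measure [simp]: "space circle_measure = sphere 0 1"
  by (simp add: circle_measure_def)

lemma sets_circle_measure [measurable_cong]:
  "sets circle_measure = sets (restrict_space borel (sphere 0 1))"
  by (simp add: circle_measure_def)

lemma measurable_cis_circle [measurable]:
  "cis \<in> borel \<rightarrow>\<^sub>M restrict_space borel (sphere 0 1)"
  by (intro measurable_restrict_space2 borel_measurable_continuous_onI) (auto intro: continuous_intros)

interpretation circle: prob_space circle_measure
  unfolding circle_measure_def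
proof (rule prob_space.prob_space_distr)
  show "prob_space (uniform_measure lborel {0..2 * pi})"
    by (rule prob_space_uniform_measure) auto
qed simp

lemma measurable_circle_mult:
  assumes "cmod u = 1"
  shows "(*) u \<in> restrict_space borel (sphere 0 1) \<rightarrow>\<^sub>M restrict_space borel (sphere 0 1)"
  using assms by (intro measurable_restrict_space2 measurable_restrict_space1) (auto simp: norm_mult)

text \<open>Writing \<open>u = cis s\<close> turns the rotation into a translation of angles by
  \<open>s\<close>, and the set of angles \<open>{t. cis t \<in> B}\<close> has period 2 pi.\<close>

lemma circle_measure_rotation:
  assumes u: "cmod u = 1"
  shows "distr circle_measure circle_measure ((*) u) = circle_measure"
proof (rule measure_eqI)
  note [measurable] = measurable_circle_mult[OF u]
  let ?S = "restrict_space borel (sphere 0 1) :: complex measure"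
  fix B assume "B \<in> sets (distr circle_measure circle_measure ((*) u))"
  then have B [measurable]: "B \<in> sets ?S"
    by (simp add: sets_circle_measure)
  obtain s where s: "0 \<le> s" "s < 2 * pi" and us: "u = cis s"
    using Arg2pi_ge_0 Arg2pi_lt_2pi Arg2pi_eq[of u] u
    by (metis cis_conv_exp mult_1 of_real_1 norm_zero zero_neq_one)
  have [measurable]: "{t. cis t \<in> B} \<in> sets borel"
    using measurable_sets[OF measurable_cis_circle B] by (simp add: vimage_def)
  have B': "{t. u * t \<in> B} \<inter> sphere 0 1 \<in> sets ?S"
    using measurable_sets[OF measurable_circle_mult[OF u] B] by (simp add: vimage_def space_restrict_space)
  have eq: "emeasure circle_measure B = emeasure (uniform_measure lborel {0..2 * pi}) {t. cis t \<in> B}"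
    if "B \<in> sets ?S" for B
    using that by (simp add: circle_measure_def emeasure_distr vimage_def)
  have "emeasure (distr circle_measure circle_measure ((*) u)) B = emeasure circle_measure ({t. u * t \<in> B} \<inter> sphere 0 1)"
    by (simp add: emeasure_distr vimage_def)
  also have "\<dots> = emeasure (uniform_measure lborel {0..2 * pi}) {t. cis (s + t) \<in> B}"
    by (subst eq[OF B']) (simp add: us cis_mult)
  also have "\<dots> = emeasure lborel {t \<in> {0..2*pi}. s + t \<in> {t. cis t \<in> B}} / emeasure lborel {0..2*pi}"
  proof -
    have "(\<lambda>t. s + t) -` {t. cis t \<in> B} \<inter> space borel \<in> sets borel"
      by (rule measurable_sets[of _ _ borel]) auto
    then have "{t. cis (s + t) \<in> B} \<in> sets borel" by (simp add: vimage_def)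
    then show ?thesis
      by (simp add: Int_def)
  qed
  also have "emeasure lborel {t \<in> {0..2*pi}. s + t \<in> {t. cis t \<in> B}} = emeasure lborel ({t. cis t \<in> B} \<inter> {0..2*pi})"
    using s by (intro emeasure_lborel_periodic) (auto simp flip: cis_mult)
  also have "\<dots> / emeasure lborel {0..2*pi} = emeasure circle_measure B"
    by (simp add: eq Int_commute)
  finally show "emeasure (distr circle_measure circle_measure ((*) u)) B = emeasure circle_measure B" .
qed simp

section \<open>The product measure on the torus\<close>

interpretation torus_prod: product_prob_space "\<lambda>_. circle_measure" "UNIV :: 'n::finite set"
  by standard

lemma prob_space_torus: "prob_space (torus :: ('n::finite \<Rightarrow> complex) measure)"
  unfolding torus_def by (rule torus_prod.prob_space_axioms)

interpretation torus: prob_space torus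
  by (rule prob_space_torus)

lemma space_torus: "space torus = {z. \<forall>i. cmod (z i) = 1}"
  by (auto simp: torus_def space_PiM PiE_def extensional_def Pi_def)

lemma cmod_torus [simp]: "z \<in> space torus \<Longrightarrow> cmod (z i) = 1"
  by (simp add: space_torus)

lemma measurable_torus_component [measurable]: "(\<lambda>z. z i) \<in> borel_measurable torus"
proof -
  have "(\<lambda>z. z i) \<in> torus \<rightarrow>\<^sub>M circle_measure"
    unfolding torus_def by measurable
  moreover have "(\<lambda>x. x) \<in> circle_measure \<rightarrow>\<^sub>M borel"
    by (simp add: measurable_cong_sets[OF sets_circle_measure refl] measurable_restrict_space1)
  ultimately show ?thesis
    by (rule measurable_compose)
qed

lemma measurable_torus_rotation:
  assumes "\<And>i. cmod (u i) = 1"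
  shows "(\<lambda>z i. u i * z i) \<in> torus \<rightarrow>\<^sub>M torus"
  unfolding torus_def
proof (rule measurable_PiM_single')
  fix i
  have "(*) (u i) \<in> circle_measure \<rightarrow>\<^sub>M circle_measure"
    using measurable_circle_mult[OF assms, of i] by (simp add: sets_circle_measure cong: measurable_cong_sets)
  then show "(\<lambda>z. u i * z i) \<in> (\<Pi>\<^sub>M i\<in>UNIV. circle_measure) \<rightarrow>\<^sub>M circle_measure"
    by measurable
qed (auto simp: space_PiM norm_mult assms PiE_def Pi_def)

text \<open>A finite product measure is determined by its values on boxes. The preimage of a box is
  a box of rotated sides, which have the same arc length.\<close>

lemma torus_rotation:
  fixes u :: "'n::finite \<Rightarrow> complex"
  assumes u: "\<And>i. cmod (u i) = 1"
  shows "distr torus torus (\<lambda>z i. u i * z i) = torus"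
proof -
  have "distr torus torus (\<lambda>z i. u i * z i) = torus"
    unfolding torus_def
  proof (rule torus_prod.PiM_eqI)
    fix A :: "'n \<Rightarrow> complex set" assume A: "\<And>i. i \<in> UNIV \<Longrightarrow> A i \<in> sets circle_measure"
    have m: "(*) (u i) \<in> circle_measure \<rightarrow>\<^sub>M circle_measure" for i
      using measurable_circle_mult[OF assms, of i] by (simp add: sets_circle_measure cong: measurable_cong_sets)
    have A': "{t. u i * t \<in> A i} \<inter> sphere 0 1 \<in> sets circle_measure" for i
      using measurable_sets[OF m A, of i] by (simp add: vimage_def)
    have "emeasure (distr (Pi\<^sub>M UNIV (\<lambda>i. circle_measure)) (Pi\<^sub>M UNIV (\<lambda>i. circle_measure)) (\<lambda>z i. u i * z i)) (Pi\<^sub>E UNIV A)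
      = emeasure (Pi\<^sub>M UNIV (\<lambda>i. circle_measure)) (Pi\<^sub>E UNIV (\<lambda>i. {t. u i * t \<in> A i} \<inter> sphere 0 1))"
      using A measurable_torus_rotation[of u, OF u, unfolded torus_def] sets_PiM_I_finite[of UNIV A "\<lambda>_. circle_measure"]
      by (subst emeasure_distr) (auto intro!: arg_cong2[where f=emeasure] simp: space_PiM PiE_def Pi_def)
    also have "\<dots> = (\<Prod>i\<in>UNIV. emeasure circle_measure ({t. u i * t \<in> A i} \<inter> sphere 0 1))"
      using A' by (subst torus_prod.emeasure_PiM) auto
    also have "\<dots> = (\<Prod>i\<in>UNIV. emeasure (distr circle_measure circle_measure ((*) (u i))) (A i))"
      using A m by (simp add: emeasure_distr vimage_def)
    also have "\<dots> = (\<Prod>i\<in>UNIV. emeasure circle_measure (A i))"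
      by (simp add: circle_measure_rotation u)
    finally show "emeasure (distr (Pi\<^sub>M UNIV (\<lambda>i. circle_measure)) (Pi\<^sub>M UNIV (\<lambda>i. circle_measure)) (\<lambda>z i. u i * z i)) (Pi\<^sub>E UNIV A)
      = (\<Prod>i\<in>UNIV. emeasure circle_measure (A i))" .
  qed auto
  then show ?thesis .
qed

lemma integral_torus_rotation:
  fixes f :: "('n::finite \<Rightarrow> complex) \<Rightarrow> 'b::{banach,second_countable_topology}"
  assumes u: "\<And>i. cmod (u i) = 1" and f: "f \<in> borel_measurable torus"
  shows "(LINT z|torus. f (\<lambda>i. u i * z i)) = (LINT z|torus. f z)"
  using integral_distr[OF measurable_torus_rotation[of u, OF u] f] by (simp add: torus_rotation[of u, OF u])

lemma AE_torus_rotation: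
  fixes u :: "'n::finite \<Rightarrow> complex"
  assumes u: "\<And>i. cmod (u i) = 1" and P: "AE z in torus. P z"
  shows "AE z in torus. P (\<lambda>i. u i * z i)"
proof -
  have "AE z in distr torus torus (\<lambda>z i. u i * z i). P z" 
    unfolding torus_rotation[of u, OF u] by (rule P)
  from AE_distrD[OF measurable_torus_rotation[of u, OF u] this] show ?thesis .
qed

section \<open>Means of functions of the three monomials\<close>

text \<open>Joint continuity on all of complex 3-space is closed under composition without any side
  condition on domains.\<close>

definition cont3 :: "(complex \<Rightarrow> complex \<Rightarrow> complex \<Rightarrow> 'a::topological_space) \<Rightarrow> bool" where
  "cont3 F \<longleftrightarrow> continuous_on UNIV (\<lambda>p. F (fst p) (fst (snd p)) (snd (snd p)))"

text \<open>The exponent matrix of the three monomials has determinant 9, so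
  \<open>(a, b, c)\<close> is itself uniformly distributed on the torus. This enters through the
  rotation and cyclic invariance shown below.\<close>

definition mean3 :: "(complex \<Rightarrow> complex \<Rightarrow> complex \<Rightarrow> 'a::{banach,second_countable_topology}) \<Rightarrow> 'a" where
  "mean3 F = (LINT z|torus. F (z (1::3) ^ 3) (z 2 ^ 3) (z 1 * z 2 * z 3))"

lemma cont3_compose:
  assumes "cont3 F" "cont3 f" "cont3 g" "cont3 h"
  shows "cont3 (\<lambda>a b c. F (f a b c) (g a b c) (h a b c))"
proof -
  let ?g = "\<lambda>p. (f (fst p) (fst (snd p)) (snd (snd p)), g (fst p) (fst (snd p)) (snd (snd p)),
    h (fst p) (fst (snd p)) (snd (snd p)))"
  have "continuous_on UNIV ?g"
    using assms(2-4) unfolding cont3_def by (intro continuous_on_Pair)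
  from continuous_on_compose2[OF assms(1)[unfolded cont3_def] this] show ?thesis
    by (simp add: cont3_def)
qed

lemma cont3_proj [intro]: "cont3 (\<lambda>a b c. a)" "cont3 (\<lambda>a b c. b)" "cont3 (\<lambda>a b c. c)"
  by (auto simp: cont3_def intro!: continuous_intros)

lemma measurable_cont3:
  fixes F :: "complex \<Rightarrow> complex \<Rightarrow> complex \<Rightarrow> 'a::topological_space"
  assumes "cont3 F" and [measurable]: "f \<in> borel_measurable M" "g \<in> borel_measurable M" "h \<in> borel_measurable M"
  shows "(\<lambda>x. F (f x) (g x) (h x)) \<in> borel_measurable M"
proof -
  have "(\<lambda>p. F (fst p) (fst (snd p)) (snd (snd p))) \<in> borel_measurable borel"
    using assms(1) unfolding cont3_def by (rule borel_measurable_continuous_onI)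
  moreover have "(\<lambda>x. (f x, g x, h x)) \<in> borel_measurable M"
    by measurable
  ultimately show ?thesis
    using measurable_compose[of "\<lambda>x. (f x, g x, h x)" M borel "\<lambda>p. F (fst p) (fst (snd p)) (snd (snd p))" borel] by simp
qed

lemma bounded_cont3:
  fixes F :: "complex \<Rightarrow> complex \<Rightarrow> complex \<Rightarrow> 'a::real_normed_vector"
  assumes "cont3 F"
  obtains C where "\<And>a b c. cmod a = 1 \<Longrightarrow> cmod b = 1 \<Longrightarrow> cmod c = 1 \<Longrightarrow> norm (F a b c) \<le> C"
proof -
  let ?f = "\<lambda>p. F (fst p) (fst (snd p)) (snd (snd p))"
  have "compact (?f ` (sphere 0 1 \<times> sphere 0 1 \<times> sphere 0 1))"
    using assms unfolding cont3_def
    by (intro compact_continuous_image compact_Times) (auto intro: continuous_on_subset)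
  then obtain C where "\<And>x. x \<in> ?f ` (sphere 0 1 \<times> sphere 0 1 \<times> sphere 0 1) \<Longrightarrow> norm x \<le> C"
    by (meson bounded_iff compact_imp_bounded)
  from this[OF imageI] have "norm (F a b c) \<le> C" if "cmod a = 1" "cmod b = 1" "cmod c = 1" for a b c
    using that by (metis SigmaI fst_conv snd_conv mem_sphere_0)
  then show ?thesis by (rule that)
qed

lemma integrable_cont3:
  fixes F :: "complex \<Rightarrow> complex \<Rightarrow> complex \<Rightarrow> 'a::{banach,second_countable_topology}"
  assumes "cont3 F"
  shows "integrable torus (\<lambda>z. F (z (1::3) ^ 3) (z 2 ^ 3) (z 1 * z 2 * z 3))"
proof -
  obtain C where C: "\<And>a b c. cmod a = 1 \<Longrightarrow> cmod b = 1 \<Longrightarrow> cmod c = 1 \<Longrightarrow> norm (F a b c) \<le> C"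
    using bounded_cont3[OF assms] by blast
  show ?thesis
    by (rule torus.integrable_const_bound[where B=C])
      (auto intro!: C AE_I2 measurable_cont3[OF assms] simp: norm_power norm_mult)
qed

lemma obtain_cube_root:
  assumes "cmod u = 1" obtains x where "cmod x = 1" "x ^ 3 = u"
proof -
  have "cis (Arg u) = u"
    using cis_Arg[of u] assms by (cases "u = 0") (auto simp: sgn_eq)
  moreover have "cis (Arg u / 3) ^ 3 = cis (Arg u)"
    by (subst Complex.DeMoivre) simp
  ultimately show ?thesis
    by (intro that[of "cis (Arg u / 3)"]) simp_all
qed

text \<open>Every rotation of the triple \<open>(a, b, c)\<close> lifts to a rotation of the torus:
  cube roots settle the first two coordinates, and the third coordinate is then free to produce
  \<open>w\<close>.\<close>

lemma obtain_rotation3: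
  assumes "cmod u = 1" "cmod v = 1" "cmod w = 1"
  obtains r :: "3 \<Rightarrow> complex" where "\<And>i. cmod (r i) = 1" "r 1 ^ 3 = u" "r 2 ^ 3 = v" "r 1 * r 2 * r 3 = w"
proof -
  obtain x y where x: "cmod x = 1" "x ^ 3 = u" and y: "cmod y = 1" "y ^ 3 = v"
    using assms obtain_cube_root by metis
  define r :: "3 \<Rightarrow> complex" where "r i = (if i = 1 then x else if i = 2 then y else w / (x * y))" for i
  have "(1::3) \<noteq> 2" "(1::3) \<noteq> 3" "(2::3) \<noteq> 3" by simp_all
  with x y assms show ?thesis
    by (intro that[of r]) (auto simp: r_def norm_divide norm_mult)
qed

lemma mean3_rotation:
  fixes F :: "complex \<Rightarrow> complex \<Rightarrow> complex \<Rightarrow> 'a::{banach,second_countable_topology}"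
  assumes F: "cont3 F" and "cmod u = 1" "cmod v = 1" "cmod w = 1"
  shows "mean3 (\<lambda>a b c. F (u * a) (v * b) (w * c)) = mean3 F"
proof -
  obtain r :: "3 \<Rightarrow> complex" where r: "\<And>i. cmod (r i) = 1" "r 1 ^ 3 = u" "r 2 ^ 3 = v" "r 1 * r 2 * r 3 = w"
    using obtain_rotation3[OF assms(2-4)] by blast
  have "(LINT z|torus. F ((r 1 * z (1::3)) ^ 3) ((r 2 * z 2) ^ 3) ((r 1 * z 1) * (r 2 * z 2) * (r 3 * z 3))) = mean3 F"
    unfolding mean3_def
    by (rule integral_torus_rotation[where u=r, OF r(1)]) (intro measurable_cont3[OF F]; measurable)
  moreover have "(r (1::3) * z 1) * (r 2 * z 2) * (r 3 * z 3) = w * (z 1 * z 2 * z 3)" for z :: "3 \<Rightarrow> complex"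
    using r(4) by (simp add: ac_simps)
  ultimately show ?thesis
    by (simp add: mean3_def power_mult_distrib r)
qed

lemma AE_mean3_rotation:
  assumes "AE z in torus. P (z (1::3) ^ 3) (z 2 ^ 3) (z 1 * z 2 * z 3)"
    and "cmod u = 1" "cmod v = 1" "cmod w = 1"
  shows "AE z in torus. P (u * z (1::3) ^ 3) (v * z 2 ^ 3) (w * (z 1 * z 2 * z 3))"
proof -
  obtain r :: "3 \<Rightarrow> complex" where r: "\<And>i. cmod (r i) = 1" "r 1 ^ 3 = u" "r 2 ^ 3 = v" "r 1 * r 2 * r 3 = w"
    using obtain_rotation3[OF assms(2-4)] by blast
  have "(r (1::3) * z 1) * (r 2 * z 2) * (r 3 * z 3) = w * (z 1 * z 2 * z 3)" for z :: "3 \<Rightarrow> complex"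
    using r(4) by (simp add: ac_simps)
  with AE_torus_rotation[where u=r, OF r(1) assms(1)] show ?thesis
    by (simp add: power_mult_distrib r)
qed

text \<open>Average \<open>F (a(z) b(u)) (b(z) c(u)) (c(z) a(u))\<close> over \<open>z\<close> and \<open>u\<close>: by rotation invariance, integrating
  over \<open>z\<close> first gives one side and integrating over \<open>u\<close> first gives the other.\<close>

lemma mean3_cyclic:
  fixes F :: "complex \<Rightarrow> complex \<Rightarrow> complex \<Rightarrow> 'a::{banach,second_countable_topology}"
  assumes F: "cont3 F"
  shows "mean3 (\<lambda>a b c. F b c a) = mean3 F"
proof -
  have F': "cont3 (\<lambda>a b c. F b c a)"
    by (rule cont3_compose[OF F]) auto
  obtain C where C: "\<And>a b c. cmod a = 1 \<Longrightarrow> cmod b = 1 \<Longrightarrow> cmod c = 1 \<Longrightarrow> norm (F a b c) \<le> C"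
    using bounded_cont3[OF assms] by blast
  interpret pair: pair_prob_space "torus :: (3 \<Rightarrow> complex) measure" "torus :: (3 \<Rightarrow> complex) measure" ..
  define K where "K z u = F (z 1 ^ 3 * u 2 ^ 3) (z 2 ^ 3 * (u 1 * u 2 * u 3)) ((z 1 * z 2 * z 3) * u 1 ^ 3)"
    for z u :: "3 \<Rightarrow> complex"
  have "integrable (torus \<Otimes>\<^sub>M torus) (\<lambda>(z, u). K z u)"
  proof (rule pair.P.integrable_const_bound[where B=C])
    show "AE x in torus \<Otimes>\<^sub>M torus. norm (case x of (z, u) \<Rightarrow> K z u) \<le> C"
      by (auto intro!: AE_I2 C simp: K_def space_pair_measure norm_mult norm_power)
    show "(\<lambda>(z, u). K z u) \<in> borel_measurable (torus \<Otimes>\<^sub>M torus)"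
      unfolding K_def case_prod_beta by (intro measurable_cont3[OF F]; measurable)
  qed
  then have "(LINT u|torus. LINT z|torus. K z u) = (LINT z|torus. LINT u|torus. K z u)"
    by (rule pair.Fubini_integral)
  moreover have "(LINT z|torus. K z u) = mean3 F" if "u \<in> space torus" for u
    using mean3_rotation[OF F, of "u 2 ^ 3" "u 1 * u 2 * u 3" "u 1 ^ 3"] that
    by (simp add: mean3_def K_def norm_mult norm_power mult.commute)
  moreover have "(LINT u|torus. K z u) = mean3 (\<lambda>a b c. F b c a)" if "z \<in> space torus" for z
    using mean3_rotation[OF F', of "z 1 * z 2 * z 3" "z 1 ^ 3" "z 2 ^ 3"] that
    by (simp add: mean3_def K_def norm_mult norm_power)
  ultimately show ?thesis
    by (simp cong: Bochner_Integration.integral_cong add: torus.prob_space)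
qed

lemma mean3_LIMSEQ:
  fixes F :: "complex \<Rightarrow> complex \<Rightarrow> complex \<Rightarrow> real"
  assumes G: "\<And>n. cont3 (G n)" and F: "cont3 F"
    and lim: "\<And>a b c. cmod a = 1 \<Longrightarrow> cmod b = 1 \<Longrightarrow> cmod c = 1 \<Longrightarrow> (\<lambda>n. G n a b c) \<longlonglongrightarrow> F a b c"
    and bound: "\<And>n a b c. cmod a = 1 \<Longrightarrow> cmod b = 1 \<Longrightarrow> cmod c = 1 \<Longrightarrow> norm (G n a b c) \<le> C"
  shows "(\<lambda>n. mean3 (G n)) \<longlonglongrightarrow> mean3 F"
  unfolding mean3_def
proof (rule integral_dominated_convergence[where w="\<lambda>_. C"])
  show "(\<lambda>z. F (z (1::3) ^ 3) (z 2 ^ 3) (z 1 * z 2 * z 3)) \<in> borel_measurable torus"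
    by (intro measurable_cont3[OF F]; measurable)
  show "(\<lambda>z. G n (z (1::3) ^ 3) (z 2 ^ 3) (z 1 * z 2 * z 3)) \<in> borel_measurable torus" for n
    by (intro measurable_cont3[OF G]; measurable)
  show "AE z in torus. (\<lambda>n. G n (z (1::3) ^ 3) (z 2 ^ 3) (z 1 * z 2 * z 3)) \<longlonglongrightarrow>
      F (z 1 ^ 3) (z 2 ^ 3) (z 1 * z 2 * z 3)"
    by (intro AE_I2 lim) (simp_all add: norm_mult norm_power)
  show "AE z in torus. norm (G n (z (1::3) ^ 3) (z 2 ^ 3) (z 1 * z 2 * z 3)) \<le> C" for n
    by (intro AE_I2 bound) (simp_all add: norm_mult norm_power)
qed simp

text \<open>This is integration by parts without boundary terms. By rotation invariance every
  difference quotient has mean zero, and dominated convergence carries this over to the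
  derivative.\<close>

lemma mean3_rotation_derivative:
  fixes F F' :: "complex \<Rightarrow> complex \<Rightarrow> complex \<Rightarrow> real"
  assumes F: "cont3 F" and F': "cont3 F'"
    and deriv: "\<And>a b c. ((\<lambda>t. F (cis t * a) b c) has_real_derivative F' a b c) (at 0)"
  shows "mean3 F' = 0"
proof -
  obtain C where C: "\<And>a b c. cmod a = 1 \<Longrightarrow> cmod b = 1 \<Longrightarrow> cmod c = 1 \<Longrightarrow> norm (F' a b c) \<le> C"
    using bounded_cont3[OF F'] by blast
  \<comment> \<open>Since \<open>cis (t + s) = cis s * cis t\<close>, the derivative at angle 0 from
    the rotated base point is the derivative at angle \<open>t\<close>.\<close>
  have deriv_at: "((\<lambda>t. F (cis t * a) b c) has_real_derivative F' (cis t * a) b c) (at t)" for a b c t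
  proof -
    have "((\<lambda>s. F (cis (t + s) * a) b c) has_real_derivative F' (cis t * a) b c) (at 0)"
      using deriv[of "cis t * a" b c] by (simp add: cis_mult mult.assoc[symmetric] add.commute)
    then show ?thesis
      using DERIV_shift[of "\<lambda>s. F (cis s * a) b c" "F' (cis t * a) b c" 0 t] by (simp add: add.commute)
  qed
  define e where "e n = 1 / real (Suc n)" for n
  have e: "e n > 0" "e n \<noteq> 0" for n by (auto simp: e_def)
  have e0: "e \<longlonglongrightarrow> 0"
    unfolding e_def using LIMSEQ_inverse_real_of_nat by (simp add: inverse_eq_divide)
  define q where "q n a b c = (F (cis (e n) * a) b c - F a b c) / e n" for n a b c
  have cq: "cont3 (\<lambda>a b c. F (cis (e n) * a) b c)" for n
    by (rule cont3_compose[OF F]) (auto simp: cont3_def intro!: continuous_intros)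
  have "mean3 (q n) = 0" for n
  proof -
    have "mean3 (q n) = (mean3 (\<lambda>a b c. F (cis (e n) * a) b c) - mean3 F) / e n"
      unfolding q_def mean3_def using e[of n] integrable_cont3[OF F] integrable_cont3[OF cq] by simp
    then show ?thesis
      using mean3_rotation[OF F, of "cis (e n)" 1 1] by simp
  qed
  moreover have "(\<lambda>n. mean3 (q n)) \<longlonglongrightarrow> mean3 F'"
  proof (rule mean3_LIMSEQ[where C=C])
    show "cont3 (q n)" for n
      using cq[of n] F e[of n] unfolding q_def cont3_def by (intro continuous_intros) auto
    fix a b c :: complex
    have "((\<lambda>t. (F (cis t * a) b c - F a b c) / t) \<longlongrightarrow> F' a b c) (at 0)"
      using deriv[of a b c] by (simp add: has_field_derivative_iff)
    moreover have "filterlim e (at 0) sequentially"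
      using e0 e by (auto simp: filterlim_at)
    ultimately show "(\<lambda>n. q n a b c) \<longlonglongrightarrow> F' a b c"
      unfolding q_def by (rule filterlim_compose)
    fix n assume unit: "cmod a = 1" "cmod b = 1" "cmod c = 1"
    \<comment> \<open>By the mean value theorem the quotient is a value of \<open>F'\<close> at a
      rotated point, so the bound \<open>C\<close> for \<open>F'\<close> dominates all
      quotients.\<close>
    obtain t where "F (cis (e n) * a) b c - F (cis 0 * a) b c = (e n - 0) * F' (cis t * a) b c"
      using MVT2[OF e(1)[of n], of "\<lambda>t. F (cis t * a) b c" "\<lambda>t. F' (cis t * a) b c"] deriv_at by blast
    then have "q n a b c = F' (cis t * a) b c"
      using e[of n] by (simp add: q_def)
    then show "norm (q n a b c) \<le> C"
      using C unit by (simp add: norm_mult)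
  qed (rule F')
  ultimately show ?thesis
    by (simp add: LIMSEQ_const_iff)
qed

text \<open>The rotations of one point by rational angles are dense in the torus. By invariance and
  countability, some point satisfies the bound together with all these rotations, and continuity
  does the rest.\<close>

lemma torus3_full_support:
  fixes F :: "complex \<Rightarrow> complex \<Rightarrow> complex \<Rightarrow> real"
  assumes F: "cont3 F" and AE: "AE z in torus. F (z (1::3) ^ 3) (z 2 ^ 3) (z 1 * z 2 * z 3) \<le> m"
    and unit: "cmod a = 1" "cmod b = 1" "cmod c = 1"
  shows "F a b c \<le> m"
proof -
  have "AE z in torus. \<forall>q::rat\<times>rat\<times>rat. F (cis (of_rat (fst q)) * z (1::3) ^ 3) (cis (of_rat (fst (snd q))) * z 2 ^ 3)
      (cis (of_rat (snd (snd q))) * (z 1 * z 2 * z 3)) \<le> m"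
    unfolding AE_all_countable by (intro allI AE_mean3_rotation[OF AE]) simp_all
  with AE_space have "AE z in torus. z \<in> space torus \<and> (\<forall>q::rat\<times>rat\<times>rat.
      F (cis (of_rat (fst q)) * z (1::3) ^ 3) (cis (of_rat (fst (snd q))) * z 2 ^ 3)
      (cis (of_rat (snd (snd q))) * (z 1 * z 2 * z 3)) \<le> m)" (is "AE z in torus. ?P z")
    by eventually_elim simp
  moreover have "ae_filter (torus :: (3 \<Rightarrow> complex) measure) \<noteq> bot"
    by (simp add: ae_filter_eq_bot_iff torus.emeasure_space_1)
  ultimately obtain z where z: "?P z"
    using eventually_happens' by blast
  then have le: "F (cis (of_rat q) * z (1::3) ^ 3) (cis (of_rat r) * z 2 ^ 3) (cis (of_rat s) * (z 1 * z 2 * z 3)) \<le> m"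
    for q r s
    by (metis fst_conv snd_conv)
  \<comment> \<open>Any unit number is a rotation of any other, by an angle that is a limit of
    rationals.\<close>
  have ex: "\<exists>t q. u = cis t * v \<and> (\<lambda>n. of_rat (q n)) \<longlonglongrightarrow> t" if "cmod u = 1" "cmod v = 1" for u v
  proof -
    have "cmod (u / v) = 1" using that by (simp add: norm_divide)
    then have "cis (Arg (u / v)) = u / v"
      using cis_Arg[of "u / v"] by (cases "u / v = 0") (auto simp: sgn_eq)
    then have "u = cis (Arg (u / v)) * v"
      using that by (auto simp: field_simps)
    moreover have "\<exists>q::nat \<Rightarrow> rat. (\<lambda>n. of_rat (q n)) \<longlonglongrightarrow> (t::real)" for t
    proof -
      have "\<exists>q::rat. \<bar>of_rat q - t\<bar> < inverse (real (Suc n))" for n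
      proof -
        have "0 < inverse (real (Suc n))" by simp
        then obtain q :: rat where "t - inverse (real (Suc n)) < of_rat q" "of_rat q < t + inverse (real (Suc n))"
          using of_rat_dense[of "t - inverse (real (Suc n))" "t + inverse (real (Suc n))"] by auto
        then show ?thesis
          by (intro exI[of _ q]) linarith
      qed
      then obtain q :: "nat \<Rightarrow> rat" where q: "\<And>n. \<bar>of_rat (q n) - t\<bar> < inverse (real (Suc n))"
        by metis
      have "(\<lambda>n. of_rat (q n) - t) \<longlonglongrightarrow> 0"
        by (rule Lim_null_comparison[OF _ LIMSEQ_inverse_real_of_nat])
          (rule always_eventually, rule allI, simp only: real_norm_def, rule less_imp_le[OF q])
      then show ?thesis
        by (intro exI[of _ q]) (rule LIM_zero_cancel)
    qed
    ultimately show ?thesis by blast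
  qed
  have z': "cmod (z 1 ^ 3) = 1" "cmod (z 2 ^ 3) = 1" "cmod (z 1 * z 2 * z 3) = 1"
    using z by (simp_all add: norm_power norm_mult)
  obtain t1 q1 t2 q2 t3 q3 where
    t1: "a = cis t1 * z 1 ^ 3" and q1: "(\<lambda>n. of_rat (q1 n)) \<longlonglongrightarrow> t1" and
    t2: "b = cis t2 * z 2 ^ 3" and q2: "(\<lambda>n. of_rat (q2 n)) \<longlonglongrightarrow> t2" and
    t3: "c = cis t3 * (z 1 * z 2 * z 3)" and q3: "(\<lambda>n. of_rat (q3 n)) \<longlonglongrightarrow> t3"
    using ex[OF unit(1) z'(1)] ex[OF unit(2) z'(2)] ex[OF unit(3) z'(3)] by blast
  have cis: "(\<lambda>n. cis (of_rat (q n)) * v) \<longlonglongrightarrow> cis t * v" if "(\<lambda>n. of_rat (q n)) \<longlonglongrightarrow> t" for q t v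
    using that by (intro tendsto_intros)
  have "(\<lambda>n. (cis (of_rat (q1 n)) * z 1 ^ 3, cis (of_rat (q2 n)) * z 2 ^ 3, cis (of_rat (q3 n)) * (z 1 * z 2 * z 3)))
      \<longlonglongrightarrow> (a, b, c)"
    unfolding t1 t2 t3 by (intro tendsto_Pair cis q1 q2 q3)
  then have "(\<lambda>n. F (cis (of_rat (q1 n)) * z 1 ^ 3) (cis (of_rat (q2 n)) * z 2 ^ 3) (cis (of_rat (q3 n)) * (z 1 * z 2 * z 3)))
      \<longlonglongrightarrow> F a b c"
    using continuous_on_tendsto_compose[OF F[unfolded cont3_def], of "\<lambda>n. (cis (of_rat (q1 n)) * z 1 ^ 3,
      cis (of_rat (q2 n)) * z 2 ^ 3, cis (of_rat (q3 n)) * (z 1 * z 2 * z 3))" "(a, b, c)"] by simp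
  then show ?thesis
    by (rule LIMSEQ_le_const2) (use le in auto)
qed

section \<open>The invariants and their gradients\<close>

definition invR :: "complex \<Rightarrow> complex \<Rightarrow> complex \<Rightarrow> real" where
  "invR a b c = (cmod (a + b + c))\<^sup>2"

text \<open>On the unit circle \<open>cnj (a * b * c)\<close> is the inverse of
  \<open>a * b * c\<close>. Conjugation in place of division keeps the function continuous
  everywhere, as \<open>cont3\<close> asks.\<close>

definition invX :: "complex \<Rightarrow> complex \<Rightarrow> complex \<Rightarrow> real" where
  "invX a b c = Re ((a + b + c) ^ 3 * cnj (a * b * c))"

text \<open>\<open>dR\<close> and \<open>dX\<close> are the derivatives of \<open>invR\<close> and
  \<open>invX\<close> when \<open>a\<close> is rotated, \<open>ddR\<close> and \<open>ddX\<close>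
  the second derivatives. The other two variables are reached by permuting the arguments
  cyclically.\<close>

definition dR :: "complex \<Rightarrow> complex \<Rightarrow> complex \<Rightarrow> real" where
  "dR a b c = - 2 * Im (a * cnj (a + b + c))"

definition dX :: "complex \<Rightarrow> complex \<Rightarrow> complex \<Rightarrow> real" where
  "dX a b c = - Im (3 * a * (a + b + c)\<^sup>2 * cnj (a * b * c) - (a + b + c) ^ 3 * cnj (a * b * c))"

definition ddR :: "complex \<Rightarrow> complex \<Rightarrow> complex \<Rightarrow> real" where
  "ddR a b c = - 2 * Re (a * cnj (a + b + c) - a * cnj a)"

definition ddX :: "complex \<Rightarrow> complex \<Rightarrow> complex \<Rightarrow> real" where
  "ddX a b c = - Re (6 * a\<^sup>2 * (a + b + c) * cnj (a * b * c) - 3 * a * (a + b + c)\<^sup>2 * cnj (a * b * c)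
    + (a + b + c) ^ 3 * cnj (a * b * c))"

lemma invR_eq: "invR a b c = Re ((a + b + c) * cnj (a + b + c))"
  unfolding invR_def complex_norm_square[symmetric] by (simp only: Re_complex_of_real)

lemma inv_cyclic: "invR b c a = invR a b c" "invX b c a = invX a b c"
  by (simp_all add: invR_def invX_def ac_simps)

lemma has_vector_derivative_power_at:
  fixes f :: "real \<Rightarrow> complex"
  assumes "(f has_vector_derivative D) (at t)"
  shows "((\<lambda>t. f t ^ n) has_vector_derivative of_nat n * f t ^ (n - 1) * D) (at t)"
proof -
  have "((\<lambda>z. z ^ n) has_field_derivative of_nat n * f t ^ (n - 1)) (at (f t))"
    using DERIV_power[OF DERIV_ident, where x = "f t" and s = UNIV and n = n] by (simp add: mult.commute)
  from field_vector_diff_chain_at[OF assms this] show ?thesis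
    by (simp add: o_def mult_ac)
qed

lemma has_vector_derivative_cis_mult: "((\<lambda>t. cis t * a) has_vector_derivative \<i> * a) (at 0)"
proof -
  have "(cis has_vector_derivative \<i>) (at 0)"
    unfolding has_vector_derivative_complex_iff by (auto intro!: derivative_eq_intros)
  from has_vector_derivative_mult_left[OF this] show ?thesis .
qed

text \<open>Rotation differentiates \<open>cis t * a\<close> to \<open>\<i>\<close> times itself and
  its conjugate to \<open>- \<i>\<close> times itself. The factor \<open>\<i>\<close> then exchanges
  real and imaginary parts up to sign.\<close>

lemma rotation_derivatives:
  shows "((\<lambda>t. invR (cis t * a) b c) has_real_derivative dR a b c) (at 0)"
    and "((\<lambda>t. invX (cis t * a) b c) has_real_derivative dX a b c) (at 0)"
    and "((\<lambda>t. dR (cis t * a) b c) has_real_derivative ddR a b c) (at 0)"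
    and "((\<lambda>t. dX (cis t * a) b c) has_real_derivative ddX a b c) (at 0)"
proof -
  let ?A = "\<lambda>t. cis t * a" and ?W = "\<lambda>t. cis t * a + b + c" and ?E = "\<lambda>t. cnj (cis t * a * b * c)"
  let ?w = "a + b + c" and ?e = "cnj (a * b * c)"
  note A = has_vector_derivative_cis_mult[of a]
  have W: "(?W has_vector_derivative \<i> * a) (at 0)"
    using has_vector_derivative_add[OF has_vector_derivative_add[OF A has_vector_derivative_const[of b]]
      has_vector_derivative_const[of c]] by simp
  have E: "(?E has_vector_derivative - \<i> * ?e) (at 0)"
    using has_vector_derivative_mult_left[OF has_vector_derivative_cnj[OF A], of "cnj (b * c)"] by (simp add: mult_ac)
  note W2 = has_vector_derivative_power_at[OF W, of 2] and W3 = has_vector_derivative_power_at[OF W, of 3]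
  note cW = has_vector_derivative_cnj[OF W]
  have Q: "((\<lambda>t. ?W t ^ 3 * ?E t) has_vector_derivative \<i> * (3 * a * ?w\<^sup>2 * ?e - ?w ^ 3 * ?e)) (at 0)"
    by (rule has_vector_derivative_eq_rhs[OF has_vector_derivative_mult[OF W3 E]]) (simp add: algebra_simps power2_eq_square)
  have P: "((\<lambda>t. 3 * ?A t * ?W t ^ 2 * ?E t) has_vector_derivative
      \<i> * (6 * a\<^sup>2 * ?w * ?e)) (at 0)"
    by (rule has_vector_derivative_eq_rhs[OF has_vector_derivative_mult[OF has_vector_derivative_mult[OF
      has_vector_derivative_mult_right[OF A, of 3] W2] E]]) (simp add: algebra_simps power2_eq_square)
  have PQ: "((\<lambda>t. 3 * ?A t * ?W t ^ 2 * ?E t - ?W t ^ 3 * ?E t) has_vector_derivative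
      \<i> * (6 * a\<^sup>2 * ?w * ?e - 3 * a * ?w\<^sup>2 * ?e + ?w ^ 3 * ?e)) (at 0)"
    by (rule has_vector_derivative_eq_rhs[OF has_vector_derivative_diff[OF P Q]]) (simp add: algebra_simps)
  show "((\<lambda>t. invX (cis t * a) b c) has_real_derivative dX a b c) (at 0)"
    unfolding invX_def dX_def using has_field_derivative_Re[OF Q] by (simp only: Re_i_times)
  show "((\<lambda>t. dX (cis t * a) b c) has_real_derivative ddX a b c) (at 0)"
    unfolding dX_def ddX_def using DERIV_minus[OF has_field_derivative_Im[OF PQ]] by (simp only: Im_i_times)
  show "((\<lambda>t. invR (cis t * a) b c) has_real_derivative dR a b c) (at 0)"
    using has_field_derivative_Re[OF has_vector_derivative_mult[OF W cW]]
    by (simp add: invR_eq[abs_def] dR_def algebra_simps)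
  show "((\<lambda>t. dR (cis t * a) b c) has_real_derivative ddR a b c) (at 0)"
    using DERIV_cmult[OF has_field_derivative_Im[OF has_vector_derivative_mult[OF A cW]], of "-2"]
    by (simp add: dR_def[abs_def] ddR_def algebra_simps)
qed

text \<open>The partial derivatives of both invariants are affine in a variable and its conjugate,
  with coefficients common to all three variables. This formula evaluates all their inner products
  at once; the power sums follow from \<open>a * b + b * c + c * a = a * b * c * W'\<close>.\<close>

lemma sum_affine_product:
  fixes a b c a' b' c' x y z x' y' z' W W' :: complex
  assumes "a * a' = 1" "b * b' = 1" "c * c' = 1" and W: "W = a + b + c" "W' = a' + b' + c'"
  shows "(x * a + y * a' + z) * (x' * a + y' * a' + z') + (x * b + y * b' + z) * (x' * b + y' * b' + z')
    + (x * c + y * c' + z) * (x' * c + y' * c' + z') =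
    x * x' * (W\<^sup>2 - 2 * (a * b * c) * W') + y * y' * (W'\<^sup>2 - 2 * (a' * b' * c') * W) + 3 * (x * y' + y * x')
    + (x * z' + z * x') * W + (y * z' + z * y') * W' + 3 * z * z'"
proof -
  have p: "a\<^sup>2 + b\<^sup>2 + c\<^sup>2 = W\<^sup>2 - 2 * (a * b * c) * W'" "a'\<^sup>2 + b'\<^sup>2 + c'\<^sup>2 = W'\<^sup>2 - 2 * (a' * b' * c') * W"
    using assms by algebra+
  show ?thesis
    unfolding p[symmetric] W using assms(1-3) by algebra
qed

context
  fixes a b c :: complex
  assumes unit: "cmod a = 1" "cmod b = 1" "cmod c = 1"
begin

private lemma unit_cnj: "a * cnj a = 1" "b * cnj b = 1" "c * cnj c = 1"
  using unit by (simp_all add: complex_norm_square[symmetric])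

text \<open>These are the inner products of the gradients of \<open>invR\<close> and
  \<open>invX\<close> and the two Laplacians. That all of them are polynomials in the two invariants
  reduces the integration by parts to an identity in two real variables.\<close>

lemma gram:
  shows "dR a b c * dR a b c + dR b c a * dR b c a + dR c a b * dR c a b =
      4 * invX a b c + 6 * invR a b c - 2 * (invR a b c)\<^sup>2" (is ?RR)
    and "dR a b c * dX a b c + dR b c a * dX b c a + dR c a b * dX c a b =
      9 * invX a b c - 3 * invR a b c * invX a b c + 6 * (invR a b c)\<^sup>2" (is ?RX)
    and "4 * (dX a b c * dX a b c + dX b c a * dX b c a + dX c a b * dX c a b) =
      - 24 * (invX a b c)\<^sup>2 + 36 * invR a b c * invX a b c + 54 * (invR a b c)\<^sup>2 + 6 * invR a b c ^ 3" (is ?XX)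
    and "ddR a b c + ddR b c a + ddR c a b = 6 - 2 * invR a b c" (is ?LR)
    and "ddX a b c + ddX b c a + ddX c a b = - 6 * invX a b c + 12 * invR a b c" (is ?LX)
proof -
  define W e W' e' where "W = a + b + c" and "e = a * b * c" and "W' = cnj a + cnj b + cnj c"
    and "e' = cnj a * cnj b * cnj c"
  have cnjs: "cnj W = W'" "cnj W' = W" "cnj e = e'" "cnj e' = e"
    by (simp_all add: W_def W'_def e_def e'_def)
  \<comment> \<open>With \<open>t\<close> in place of the imaginary unit, \<open>algebra\<close> can
    treat it as an unknown subject to \<open>4 * t * t = - 1\<close>.\<close>
  define t where "t = \<i> / 2"
  have t2: "4 * t * t = - 1" and i2: "\<i> = 2 * t"
    by (simp_all add: t_def)
  have ee': "e * e' = 1"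
    unfolding e_def e'_def using unit_cnj by algebra
  \<comment> \<open>\<open>u\<close> and \<open>v\<close> are conjugate, and \<open>W * u\<close> is
    the quantity whose real part is \<open>invX\<close>.\<close>
  define u v where "u = W\<^sup>2 * e'" and "v = W'\<^sup>2 * e"
  have uv: "u * e = W\<^sup>2" "v * e' = W'\<^sup>2" "u * v = W\<^sup>2 * W'\<^sup>2"
    unfolding u_def v_def using ee' by algebra+
  have cyc: "b + c + a = W" "c + a + b = W" "a + b + c = W" "b * c * a = e" "c * a * b = e" "a * b * c = e"
    by (simp_all add: W_def e_def ac_simps)
  have Im: "complex_of_real (- Im z) = \<i> / 2 * (z - cnj z)" for z
    by (simp add: complex_eq_iff)
  have Re: "complex_of_real (Re z) = (z + cnj z) / 2" for z
    by (simp add: complex_eq_iff)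
  have R: "complex_of_real (invR a b c) = W * W'"
    by (simp add: invR_def cyc complex_norm_square cnjs del: of_real_power)
  have X: "complex_of_real (invX a b c) = (W * u + W' * v) / 2"
    unfolding invX_def cyc Re by (simp only: complex_cnj_mult complex_cnj_power complex_cnj_cnj cnjs u_def v_def power2_eq_square power3_eq_cube mult.assoc)
  have "complex_of_real (- 2 * Im (u * cnj W)) = \<i> * W' * u + (- \<i> * W) * cnj u + 0" for u
    using Im[of "u * cnj W"] by (simp add: cnjs algebra_simps)
  then have dR: "complex_of_real (dR a b c) = \<i> * W' * a + (- \<i> * W) * cnj a + 0"
    "complex_of_real (dR b c a) = \<i> * W' * b + (- \<i> * W) * cnj b + 0"
    "complex_of_real (dR c a b) = \<i> * W' * c + (- \<i> * W) * cnj c + 0"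
    unfolding dR_def cyc by blast+
  have "complex_of_real (- Im (3 * s * W\<^sup>2 * cnj e - W ^ 3 * cnj e)) =
      3 * t * u * s + (- 3 * t * v) * cnj s + (- t * (W * u - W' * v))" for s
    unfolding Im complex_cnj_mult complex_cnj_power complex_cnj_diff complex_cnj_numeral complex_cnj_cnj cnjs t_def u_def v_def
    by (simp add: field_simps power2_eq_square power3_eq_cube)
  then have dX:
    "complex_of_real (dX a b c) = 3 * t * u * a + (- 3 * t * v) * cnj a + (- t * (W * u - W' * v))"
    "complex_of_real (dX b c a) = 3 * t * u * b + (- 3 * t * v) * cnj b + (- t * (W * u - W' * v))"
    "complex_of_real (dX c a b) = 3 * t * u * c + (- 3 * t * v) * cnj c + (- t * (W * u - W' * v))"
    unfolding dX_def cyc by blast+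
  note sp = sum_affine_product[OF unit_cnj W_def W'_def, folded e_def e'_def]
  have "complex_of_real (dR a b c * dR a b c + dR b c a * dR b c a + dR c a b * dR c a b) =
      complex_of_real (4 * invX a b c + 6 * invR a b c - 2 * (invR a b c)\<^sup>2)"
    unfolding of_real_add of_real_diff of_real_mult of_real_power of_real_numeral R X dR sp using u_def v_def t2 unfolding i2 by algebra
  then show ?RR by (simp only: of_real_eq_iff)
  have "complex_of_real (dR a b c * dX a b c + dR b c a * dX b c a + dR c a b * dX c a b) =
      complex_of_real (9 * invX a b c - 3 * invR a b c * invX a b c + 6 * (invR a b c)\<^sup>2)"
    unfolding of_real_add of_real_diff of_real_mult of_real_power of_real_numeral R X dR dX sp using uv t2 unfolding i2 by algebra
  then show ?RX by (simp only: of_real_eq_iff)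
  have XX: "4 * (3 * t * u * (3 * t * u) * (W\<^sup>2 - 2 * e * W') + - 3 * t * v * (- 3 * t * v) * (W'\<^sup>2 - 2 * e' * W) +
      3 * (3 * t * u * (- 3 * t * v) + - 3 * t * v * (3 * t * u)) +
      (3 * t * u * (- t * (W * u - W' * v)) + - t * (W * u - W' * v) * (3 * t * u)) * W +
      (- 3 * t * v * (- t * (W * u - W' * v)) + - t * (W * u - W' * v) * (- 3 * t * v)) * W' +
      3 * (- t * (W * u - W' * v)) * (- t * (W * u - W' * v))) =
    - 24 * ((W * u + W' * v) / 2)\<^sup>2 + 36 * (W * W') * ((W * u + W' * v) / 2) + 54 * (W * W')\<^sup>2 + 6 * (W * W') ^ 3"
    (is "?L = ?R")
  proof -
    \<comment> \<open>Every term is quadratic in \<open>t\<close>, so that \<open>t2\<close> removes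
      the imaginary unit altogether.\<close>
    have "?L = (4 * t * t) * (9 * u\<^sup>2 * W\<^sup>2 - 18 * u * (u * e) * W' + 9 * v\<^sup>2 * W'\<^sup>2 - 18 * v * (v * e') * W - 54 * (u * v)
      - 6 * u * (W * u - W' * v) * W + 6 * v * (W * u - W' * v) * W' + 3 * (W * u - W' * v)\<^sup>2)"
      by (simp add: algebra_simps power2_eq_square)
    also have "\<dots> = - 6 * (W * u + W' * v)\<^sup>2 + 18 * W * W' * (W * u + W' * v) + 54 * (u * v) + 6 * (W * W') * (u * v)"
      unfolding uv(1,2) t2 by (simp add: algebra_simps power2_eq_square)
    also have "\<dots> = ?R"
      unfolding uv(3) by (simp add: field_simps power2_eq_square power3_eq_cube)
    finally show ?thesis .
  qed
  have "complex_of_real (4 * (dX a b c * dX a b c + dX b c a * dX b c a + dX c a b * dX c a b)) =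
      complex_of_real (- 24 * (invX a b c)\<^sup>2 + 36 * invR a b c * invX a b c + 54 * (invR a b c)\<^sup>2 + 6 * invR a b c ^ 3)"
    unfolding of_real_add of_real_diff of_real_mult of_real_power of_real_numeral of_real_minus R X dX sp
    by (rule XX)
  then show ?XX by (simp only: of_real_eq_iff)
  have Re_WW': "Re (W * W') = invR a b c"
    by (metis R Re_complex_of_real)
  have WW': "W * W' = a * W' + b * W' + c * W'"
    by (simp add: W_def distrib_right)
  have "ddR a b c + ddR b c a + ddR c a b = - 2 * Re (W * W' - (a * cnj a + b * cnj b + c * cnj c))"
    unfolding ddR_def cyc cnjs WW' plus_complex.sel minus_complex.sel by algebra
  then show ?LR
    unfolding unit_cnj minus_complex.sel Re_WW' by simp
  have p2: "a\<^sup>2 + b\<^sup>2 + c\<^sup>2 = W\<^sup>2 - 2 * e * W'"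
    unfolding W_def W'_def e_def using unit_cnj by algebra
  have "6 * a\<^sup>2 * W * e' + 6 * b\<^sup>2 * W * e' + 6 * c\<^sup>2 * W * e' = 6 * (a\<^sup>2 + b\<^sup>2 + c\<^sup>2) * W * e'"
    by (simp add: algebra_simps)
  also have "\<dots> = 6 * W ^ 3 * e' - 12 * (e * e') * (W * W')"
    unfolding p2 by (simp add: algebra_simps power2_eq_square power3_eq_cube)
  finally have s2: "6 * a\<^sup>2 * W * e' + 6 * b\<^sup>2 * W * e' + 6 * c\<^sup>2 * W * e' = 6 * W ^ 3 * e' - 12 * (W * W')"
    by (simp add: ee')
  have "3 * a * W\<^sup>2 * e' + 3 * b * W\<^sup>2 * e' + 3 * c * W\<^sup>2 * e' = 3 * (a + b + c) * W\<^sup>2 * e'"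
    by (simp add: algebra_simps)
  also have "\<dots> = 3 * (W ^ 3 * e')"
    by (simp add: W_def[symmetric] power2_eq_square power3_eq_cube)
  finally have "(6 * a\<^sup>2 * W * e' - 3 * a * W\<^sup>2 * e' + W ^ 3 * e') + (6 * b\<^sup>2 * W * e' - 3 * b * W\<^sup>2 * e' + W ^ 3 * e')
      + (6 * c\<^sup>2 * W * e' - 3 * c * W\<^sup>2 * e' + W ^ 3 * e') = 6 * (W ^ 3 * e') - 12 * (W * W')"
    using s2 by (simp add: algebra_simps)
  from arg_cong[OF this, of Re] have "ddX a b c + ddX b c a + ddX c a b = - (Re (6 * (W ^ 3 * e')) - Re (12 * (W * W')))"
    unfolding ddX_def cyc cnjs plus_complex.sel minus_complex.sel by linarith
  also have "\<dots> = - 6 * Re (W ^ 3 * e') + 12 * Re (W * W')"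
  proof -
    have "Re (6 * z) = 6 * Re z" "Re (12 * z) = 12 * Re z" for z
      by simp_all
    then show ?thesis
      by (simp only:)
  qed
  finally show ?LX
    unfolding Re_WW' invX_def cyc cnjs .
qed

end

text \<open>The right-hand side is the squared modulus of
  \<open>(a - b) * (b - c) * (c - a)\<close>, whose square is the discriminant of the cubic with
  roots \<open>a\<close>, \<open>b\<close>, \<open>c\<close>.\<close>

lemma vandermonde_bound:
  assumes unit: "cmod a = 1" "cmod b = 1" "cmod c = 1"
  shows "0 \<le> 27 - 18 * invR a b c - (invR a b c)\<^sup>2 + 8 * invX a b c"
proof -
  have uc: "a * cnj a = 1" "b * cnj b = 1" "c * cnj c = 1"
    using unit by (simp_all add: complex_norm_square[symmetric])
  define W e W' e' where "W = a + b + c" and "e = a * b * c" and "W' = cnj a + cnj b + cnj c"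
    and "e' = cnj a * cnj b * cnj c"
  have e2: "a * b + b * c + c * a = e * W'"
    unfolding e_def W'_def using uc by algebra
  define V where "V = (a - b) * (b - c) * (c - a)"
  define s where "s = e * W'"
  \<comment> \<open>This is the classical discriminant formula in the elementary symmetric functions
    \<open>W\<close>, \<open>s\<close>, \<open>e\<close>.\<close>
  have V2: "V * V = W\<^sup>2 * s\<^sup>2 - 4 * s ^ 3 - 4 * W ^ 3 * e + 18 * W * s * e - 27 * e\<^sup>2"
    unfolding V_def s_def e2[symmetric] by (simp add: W_def e_def algebra_simps power2_eq_square power3_eq_cube)
  \<comment> \<open>For unit numbers \<open>cnj a - cnj b\<close> is
    \<open>(b - a) / (a * b)\<close>. The three sign changes leave a minus sign, so
    \<open>V * cnj V\<close> becomes \<open>- V * V\<close> divided by \<open>e\<close>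
    squared.\<close>
  have V': "e * cnj V = - V * e'"
  proof -
    have "a * b * (cnj a - cnj b) = b * (a * cnj a) - a * (b * cnj b)"
      "b * c * (cnj b - cnj c) = c * (b * cnj b) - b * (c * cnj c)"
      "c * a * (cnj c - cnj a) = a * (c * cnj c) - c * (a * cnj a)"
      by (simp_all add: algebra_simps)
    then have d: "a * b * (cnj a - cnj b) = b - a" "b * c * (cnj b - cnj c) = c - b" "c * a * (cnj c - cnj a) = a - c"
      by (simp_all add: uc)
    have "e * e * cnj V = (a * b * (cnj a - cnj b)) * (b * c * (cnj b - cnj c)) * (c * a * (cnj c - cnj a))"
      by (simp add: e_def V_def algebra_simps)
    also have "\<dots> = - V"
      unfolding d V_def by (simp add: algebra_simps)
    finally have "e * e * cnj V * e' = - V * e'"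
      by simp
    moreover have "e * e' = 1"
      unfolding e_def e'_def using uc by algebra
    ultimately show ?thesis
      by algebra
  qed
  have ee': "e * e' = 1"
    unfolding e_def e'_def using uc by algebra
  have "complex_of_real ((cmod V)\<^sup>2) = V * cnj V"
    by (rule complex_norm_square)
  also have "\<dots> = - (V * V) * e' * e'"
    using V' ee' by algebra
  also have "\<dots> = - (W\<^sup>2 * W'\<^sup>2 * (e * e')\<^sup>2 - 4 * W' ^ 3 * e * (e * e')\<^sup>2 - 4 * W ^ 3 * e' * (e * e') + 18 * W * W' * (e * e')\<^sup>2 - 27 * (e * e')\<^sup>2)"
    unfolding V2 s_def by (simp add: algebra_simps power2_eq_square power3_eq_cube)
  also have "\<dots> = 27 - 18 * (W * W') - (W * W')\<^sup>2 + 4 * (W ^ 3 * e' + W' ^ 3 * e)"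
    unfolding ee' by (simp add: algebra_simps power_mult_distrib)
  also have "W * W' = complex_of_real (invR a b c)"
    unfolding invR_def complex_norm_square by (simp add: W_def W'_def)
  also have "W ^ 3 * e' + W' ^ 3 * e = complex_of_real (2 * invX a b c)"
  proof -
    have "W ^ 3 * e' + W' ^ 3 * e = W ^ 3 * e' + cnj (W ^ 3 * e')"
      by (simp add: W_def e_def W'_def e'_def)
    also have "\<dots> = complex_of_real (2 * Re (W ^ 3 * e'))"
      by (rule complex_add_cnj)
    finally show ?thesis
      by (simp add: invX_def W_def e'_def)
  qed
  finally have "complex_of_real ((cmod V)\<^sup>2) =
      complex_of_real (27 - 18 * invR a b c - (invR a b c)\<^sup>2 + 8 * invX a b c)"
    by simp
  then have "(cmod V)\<^sup>2 = 27 - 18 * invR a b c - (invR a b c)\<^sup>2 + 8 * invX a b c"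
    by (simp only: of_real_eq_iff)
  then show ?thesis
    by (metis zero_le_power2)
qed

lemma invX_bound:
  assumes "cmod a = 1" "cmod b = 1" "cmod c = 1"
  shows "(invX a b c)\<^sup>2 \<le> invR a b c ^ 3"
proof -
  have "\<bar>invX a b c\<bar> \<le> cmod ((a + b + c) ^ 3 * cnj (a * b * c))"
    unfolding invX_def by (rule abs_Re_le_cmod)
  also have "\<dots> = cmod (a + b + c) ^ 3"
    using assms by (simp add: norm_mult norm_power)
  finally have "(invX a b c)\<^sup>2 \<le> (cmod (a + b + c) ^ 3)\<^sup>2"
    by (metis abs_ge_zero power2_abs power_mono)
  then show ?thesis
    by (simp add: invR_def power_mult[symmetric] mult.commute)
qed

text \<open>\<open>kerG\<close> is the average over cyclic permutations of \<open>Re (w a b / c\<^sup>3)\<close>, where \<open>w = a + b + c\<close>. The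
  polynomial \<open>kerT\<close> is a second antiderivative of \<open>kerG\<close> along the level sets of \<open>invR\<close>: the mean of
  \<open>h (invR) kerG\<close> equals the mean of \<open>h'' (invR) kerT\<close>. Such a \<open>kerT\<close> is determined only up to polynomials
  whose conditional expectation given \<open>invR\<close> vanishes; the term \<open>3 (r - 2)\<^sup>2 (r\<^sup>3 - x\<^sup>2)\<close> results from the choice
  that makes it nonnegative.\<close>

definition kerG :: "real \<Rightarrow> real \<Rightarrow> real" where
  "kerG r x = (2 * x + 4 * r + r * x - 4 * r\<^sup>2) / 3"

definition kerT :: "real \<Rightarrow> real \<Rightarrow> real" where
  "kerT r x = (3 * (r - 2)\<^sup>2 * (r ^ 3 - x\<^sup>2) + r\<^sup>2 / 4 * (8 * r * (9 - 5 * r - r\<^sup>2) + (r\<^sup>2 + 26 * r - 3) * x)) / 108"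

text \<open>The first summand of \<open>kerT\<close> is nonnegative by the second hypothesis. For
  the second summand, large \<open>r\<close> uses the discriminant bound, whereas for small
  \<open>r\<close> the hypotheses give \<open>\<bar>x\<bar> \<le> r\<close> and the term in
  \<open>r\<close> alone dominates.\<close>

lemma kerT_nonneg:
  assumes "0 \<le> r" "x\<^sup>2 \<le> r ^ 3" "0 \<le> 27 - 18 * r - r\<^sup>2 + 8 * x"
  shows "0 \<le> kerT r x"
proof -
  have "0 \<le> 8 * r * (9 - 5 * r - r\<^sup>2) + (r\<^sup>2 + 26 * r - 3) * x"
  proof (cases "1 \<le> r")
    case True
    \<comment> \<open>The factor of the discriminant is chosen to cancel \<open>x\<close>, and what
      remains is a perfect square. Equality occurs at \<open>r = 9\<close>, \<open>x = 27\<close>,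
      which is the case \<open>a = b = c\<close>, and at \<open>r = 1\<close>,
      \<open>x = - 1\<close>, which is the case \<open>a = b = - c\<close>.\<close>
    have "8 * (8 * r * (9 - 5 * r - r\<^sup>2) + (r\<^sup>2 + 26 * r - 3) * x) =
      (r\<^sup>2 + 26 * r - 3) * (27 - 18 * r - r\<^sup>2 + 8 * x) + ((r - 1) * (r - 9))\<^sup>2"
      by algebra
    moreover have "0 \<le> r\<^sup>2 + 26 * r - 3"
      using True by (smt (verit) zero_le_power2)
    ultimately show ?thesis
      using assms(3) by (smt (verit) mult_nonneg_nonneg zero_le_power2)
  next
    case False
    have "r ^ 3 \<le> r\<^sup>2"
      using assms(1) False by (intro power_decreasing) auto
    then have "\<bar>x\<bar> \<le> r"
      using assms(1,2) by (intro power2_le_imp_le[of "\<bar>x\<bar>"]) auto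
    moreover have "r\<^sup>2 \<le> r"
      using assms(1) False by (simp add: power2_eq_square mult_left_le_one_le)
    then have "\<bar>r\<^sup>2 + 26 * r - 3\<bar> \<le> 24" "3 \<le> 9 - 5 * r - r\<^sup>2"
      using False assms(1) by (auto simp: abs_le_iff) (use zero_le_power2[of r] in linarith)+
    ultimately have "\<bar>(r\<^sup>2 + 26 * r - 3) * x\<bar> \<le> 24 * r"
      using assms(1) by (auto simp: abs_mult intro!: mult_mono)
    moreover have "8 * r * 3 \<le> 8 * r * (9 - 5 * r - r\<^sup>2)"
      using \<open>3 \<le> 9 - 5 * r - r\<^sup>2\<close> assms(1) by (intro mult_left_mono) auto
    ultimately show ?thesis
      by linarith
  qed
  then have "0 \<le> r\<^sup>2 / 4 * (8 * r * (9 - 5 * r - r\<^sup>2) + (r\<^sup>2 + 26 * r - 3) * x)"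
    by (intro mult_nonneg_nonneg) auto
  moreover have "0 \<le> 3 * (r - 2)\<^sup>2 * (r ^ 3 - x\<^sup>2)"
    using assms(2) by (intro mult_nonneg_nonneg) auto
  ultimately show ?thesis
    unfolding kerT_def by simp
qed

text \<open>The vector fields \<open>A = fA1 \<nabla>R + fA2 \<nabla>X\<close> and \<open>B = fB1 \<nabla>R + fB2 \<nabla>X\<close> solve the linear system
  \<open>div A = kerG\<close>, \<open>A \<cdot> \<nabla>R = div B\<close>, \<open>B \<cdot> \<nabla>R = kerT\<close> for polynomial coefficients.\<close>

definition fA1 where "fA1 r x = 43 / 288 * x + 7 / 144 * r - r * x / 24 + 5 / 96 * r\<^sup>2" for r x :: real
definition fA2 where "fA2 r x = 1 / 16 - x / 72 - 401 / 2592 * r + 7 / 288 * r\<^sup>2" for r x :: real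
definition fB1 where "fB1 r x = x / 16 - 17 / 864 * r * x + 19 / 216 * r\<^sup>2 - r\<^sup>2 * x / 864 - r ^ 3 / 216" for r x :: real
definition fB2 where "fB2 r x = - 13 / 324 * x - r / 24 + 5 / 648 * r * x" for r x :: real

text \<open>The left-hand side is the divergence of \<open>h(R) A - h'(R) B\<close>, with \<open>h0, h1, h2\<close> standing for
  \<open>h, h', h''\<close>.\<close>

lemma field_identity:
  fixes r x h0 h1 h2 rr rx xx lr lx :: real
  assumes "rr = 4 * x + 6 * r - 2 * r\<^sup>2" "rx = 9 * x - 3 * r * x + 6 * r\<^sup>2"
    "4 * xx = - 24 * x\<^sup>2 + 36 * r * x + 54 * r\<^sup>2 + 6 * r ^ 3" "lr = 6 - 2 * r" "lx = - 6 * x + 12 * r"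
  shows "(h1 * fA1 r x + h0 * (7 / 144 - x / 24 + 5 / 48 * r)
       - (h2 * fB1 r x + h1 * (- 17 / 864 * x + 19 / 108 * r - r * x / 432 - r\<^sup>2 / 72))) * rr
    + (h0 * (43 / 288 - r / 24) - h1 * (1 / 16 - 17 / 864 * r - r\<^sup>2 / 864)
       + (h1 * fA2 r x + h0 * (- 401 / 2592 + 7 / 144 * r) - (h2 * fB2 r x + h1 * (- 1 / 24 + 5 / 648 * x)))) * rx
    + (h0 * (- 1 / 72) - h1 * (- 13 / 324 + 5 / 648 * r)) * xx
    + (h0 * fA1 r x - h1 * fB1 r x) * lr + (h0 * fA2 r x - h1 * fB2 r x) * lx
    = h0 * kerG r x - h2 * kerT r x"
proof -
  have xx: "xx = - 6 * x\<^sup>2 + 9 * r * x + 27 / 2 * r\<^sup>2 + 3 / 2 * r ^ 3"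
    using assms(3) by simp
  show ?thesis
    unfolding assms(1,2,4,5) xx fA1_def fA2_def fB1_def fB2_def kerG_def kerT_def
    by (simp add: field_simps power2_eq_square power3_eq_cube)
qed

section \<open>Integration by parts\<close>

lemma mean3_cong:
  assumes "\<And>a b c. cmod a = 1 \<Longrightarrow> cmod b = 1 \<Longrightarrow> cmod c = 1 \<Longrightarrow> F a b c = G a b c"
  shows "mean3 F = mean3 G"
  unfolding mean3_def
  by (rule Bochner_Integration.integral_cong) (auto intro!: assms simp: norm_mult norm_power)

lemma mean3_mono:
  fixes F G :: "complex \<Rightarrow> complex \<Rightarrow> complex \<Rightarrow> real"
  assumes "cont3 F" "cont3 G"
    and "\<And>a b c. cmod a = 1 \<Longrightarrow> cmod b = 1 \<Longrightarrow> cmod c = 1 \<Longrightarrow> F a b c \<le> G a b c"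
  shows "mean3 F \<le> mean3 G"
  unfolding mean3_def
  by (rule integral_mono) (auto intro!: assms integrable_cont3 simp: norm_mult norm_power)

lemma mean3_add:
  fixes F G :: "complex \<Rightarrow> complex \<Rightarrow> complex \<Rightarrow> real"
  assumes "cont3 F" "cont3 G"
  shows "mean3 (\<lambda>a b c. F a b c + G a b c) = mean3 F + mean3 G"
  unfolding mean3_def using assms by (intro Bochner_Integration.integral_add integrable_cont3)

lemma mean3_diff:
  fixes F G :: "complex \<Rightarrow> complex \<Rightarrow> complex \<Rightarrow> real"
  assumes "cont3 F" "cont3 G"
  shows "mean3 (\<lambda>a b c. F a b c - G a b c) = mean3 F - mean3 G"
  unfolding mean3_def using assms by (intro Bochner_Integration.integral_diff integrable_cont3)

lemma mean3_cmult:
  fixes F :: "complex \<Rightarrow> complex \<Rightarrow> complex \<Rightarrow> real"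
  shows "mean3 (\<lambda>a b c. k * F a b c) = k * mean3 F"
  unfolding mean3_def by simp

lemma mean3_cyclic_sum:
  fixes F :: "complex \<Rightarrow> complex \<Rightarrow> complex \<Rightarrow> real"
  assumes F: "cont3 F"
  shows "mean3 (\<lambda>a b c. F a b c + F b c a + F c a b) = 3 * mean3 F"
proof -
  have F1: "cont3 (\<lambda>a b c. F b c a)" and F2: "cont3 (\<lambda>a b c. F c a b)"
    by (rule cont3_compose[OF F]; blast)+
  have "mean3 (\<lambda>a b c. F a b c + F b c a + F c a b) = mean3 F + mean3 (\<lambda>a b c. F b c a) + mean3 (\<lambda>a b c. F c a b)"
    using F1 F2 F by (subst mean3_add mean3_add[of F]; auto simp: cont3_def intro!: continuous_intros)+
  then show ?thesis
    using mean3_cyclic[OF F] mean3_cyclic[OF F1] by simp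
qed

lemma continuous_inv [continuous_intros]:
  assumes "continuous_on S f" "continuous_on S g" "continuous_on S h"
  shows "continuous_on S (\<lambda>x. invR (f x) (g x) (h x))" "continuous_on S (\<lambda>x. invX (f x) (g x) (h x))"
    "continuous_on S (\<lambda>x. dR (f x) (g x) (h x))" "continuous_on S (\<lambda>x. dX (f x) (g x) (h x))"
    "continuous_on S (\<lambda>x. ddR (f x) (g x) (h x))" "continuous_on S (\<lambda>x. ddX (f x) (g x) (h x))"
  unfolding invR_def invX_def dR_def dX_def ddR_def ddX_def
  by (intro continuous_intros assms)+

lemma continuous_fields [continuous_intros]:
  assumes "continuous_on S f" "continuous_on S g"
  shows "continuous_on S (\<lambda>x. fA1 (f x) (g x))" "continuous_on S (\<lambda>x. fA2 (f x) (g x))"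
    "continuous_on S (\<lambda>x. fB1 (f x) (g x))" "continuous_on S (\<lambda>x. fB2 (f x) (g x))"
    "continuous_on S (\<lambda>x. kerG (f x) (g x))" "continuous_on S (\<lambda>x. kerT (f x) (g x))"
  unfolding fA1_def fA2_def fB1_def fB2_def kerG_def kerT_def
  by (intro continuous_intros assms; simp)+

text \<open>The factors of \<open>f'\<close> and \<open>g'\<close> are the partial derivatives in
  \<open>r\<close> and \<open>x\<close>, in the form in which \<open>field_identity\<close> contains
  them.\<close>

lemma field_derivatives:
  assumes "(f has_real_derivative f') (at t)" "(g has_real_derivative g') (at t)"
  shows "((\<lambda>t. fA1 (f t) (g t)) has_real_derivative
      (7 / 144 - g t / 24 + 5 / 48 * f t) * f' + (43 / 288 - f t / 24) * g') (at t)"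
    and "((\<lambda>t. fA2 (f t) (g t)) has_real_derivative (- 401 / 2592 + 7 / 144 * f t) * f' + (- 1 / 72) * g') (at t)"
    and "((\<lambda>t. fB1 (f t) (g t)) has_real_derivative
      (- 17 / 864 * g t + 19 / 108 * f t - f t * g t / 432 - (f t)\<^sup>2 / 72) * f' + (1 / 16 - 17 / 864 * f t - (f t)\<^sup>2 / 864) * g') (at t)"
    and "((\<lambda>t. fB2 (f t) (g t)) has_real_derivative (- 1 / 24 + 5 / 648 * g t) * f' + (- 13 / 324 + 5 / 648 * f t) * g') (at t)"
  unfolding fA1_def fA2_def fB1_def fB2_def
  by (auto intro!: derivative_eq_intros assms simp: field_simps power2_eq_square)

lemma invR_nonneg: "0 \<le> invR a b c"
  by (simp add: invR_def)

text \<open>The divergence of a vector field has mean zero. The field is the one of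
  \<open>field_identity\<close> with \<open>h\<close> the power function shifted by
  \<open>\<epsilon>\<close>, which is smooth on the range of \<open>invR\<close> because
  \<open>\<epsilon>\<close> is positive.\<close>

lemma mean3_integration_by_parts:
  fixes \<beta> \<epsilon> :: real
  assumes \<epsilon>: "0 < \<epsilon>"
  shows "mean3 (\<lambda>a b c. (invR a b c + \<epsilon>) powr \<beta> * kerG (invR a b c) (invX a b c)) =
    \<beta> * (\<beta> - 1) * mean3 (\<lambda>a b c. (invR a b c + \<epsilon>) powr (\<beta> - 2) * kerT (invR a b c) (invX a b c))"
proof -
  \<comment> \<open>These are \<open>h\<close>, its first and its second derivative.\<close>
  define h0 h1 h2 where "h0 r = (r + \<epsilon>) powr \<beta>" and "h1 r = \<beta> * (r + \<epsilon>) powr (\<beta> - 1)"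
    and "h2 r = \<beta> * (\<beta> - 1) * (r + \<epsilon>) powr (\<beta> - 2)" for r
  have h_deriv: "((\<lambda>t. h0 (f t)) has_real_derivative h1 (f t) * D) (at t)"
    "((\<lambda>t. h1 (f t)) has_real_derivative h2 (f t) * D) (at t)"
    if "(f has_real_derivative D) (at t)" "0 \<le> f t" for f D t
  proof -
    have "((\<lambda>t. f t + \<epsilon>) has_real_derivative D) (at t)"
      using that(1) by (auto intro!: derivative_eq_intros)
    from DERIV_fun_powr[OF this, of \<beta>] DERIV_cmult[OF DERIV_fun_powr[OF this, of "\<beta> - 1"], of \<beta>]
    show "((\<lambda>t. h0 (f t)) has_real_derivative h1 (f t) * D) (at t)"
      "((\<lambda>t. h1 (f t)) has_real_derivative h2 (f t) * D) (at t)"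
      using that(2) \<epsilon> by (simp_all add: h0_def h1_def h2_def mult_ac)
  qed
  have h_cont: "continuous_on S (\<lambda>x. h0 (f x))" "continuous_on S (\<lambda>x. h1 (f x))" "continuous_on S (\<lambda>x. h2 (f x))"
    if "continuous_on S f" "\<And>x. x \<in> S \<Longrightarrow> 0 \<le> f x" for S :: "(complex \<times> complex \<times> complex) set" and f
    unfolding h0_def h1_def h2_def using that \<epsilon>
    by (intro continuous_intros ballI; force)+
  \<comment> \<open>\<open>V\<close> is the component of the field in the direction of
    \<open>a\<close>. The other components arise by cyclic permutation, since the coefficients
    depend on the invariants alone.\<close>
  define V where "V a b c = (h0 (invR a b c) * fA1 (invR a b c) (invX a b c) - h1 (invR a b c) * fB1 (invR a b c) (invX a b c)) * dR a b c
    + (h0 (invR a b c) * fA2 (invR a b c) (invX a b c) - h1 (invR a b c) * fB2 (invR a b c) (invX a b c)) * dX a b c" for a b c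
  \<comment> \<open>\<open>f1R\<close>, \<open>f1X\<close> and \<open>f2R\<close>,
    \<open>f2X\<close> are the partial derivatives in \<open>r\<close> and \<open>x\<close> of the
    coefficients of \<open>dR\<close> and \<open>dX\<close> in \<open>V\<close>. They make
    \<open>D\<close> the derivative of \<open>V\<close> under rotation of \<open>a\<close>.\<close>
  define f1R where "f1R r x = h1 r * fA1 r x + h0 r * (7 / 144 - x / 24 + 5 / 48 * r)
       - (h2 r * fB1 r x + h1 r * (- 17 / 864 * x + 19 / 108 * r - r * x / 432 - r\<^sup>2 / 72))" for r x
  define f1X where "f1X r x = h0 r * (43 / 288 - r / 24) - h1 r * (1 / 16 - 17 / 864 * r - r\<^sup>2 / 864)" for r x :: real
  define f2R where "f2R r x = h1 r * fA2 r x + h0 r * (- 401 / 2592 + 7 / 144 * r) - (h2 r * fB2 r x + h1 r * (- 1 / 24 + 5 / 648 * x))" for r x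
  define f2X where "f2X r x = h0 r * (- 1 / 72) - h1 r * (- 13 / 324 + 5 / 648 * r)" for r x :: real
  define D where "D a b c = (f1R (invR a b c) (invX a b c) * dR a b c + f1X (invR a b c) (invX a b c) * dX a b c) * dR a b c
    + (h0 (invR a b c) * fA1 (invR a b c) (invX a b c) - h1 (invR a b c) * fB1 (invR a b c) (invX a b c)) * ddR a b c
    + (f2R (invR a b c) (invX a b c) * dR a b c + f2X (invR a b c) (invX a b c) * dX a b c) * dX a b c
    + (h0 (invR a b c) * fA2 (invR a b c) (invX a b c) - h1 (invR a b c) * fB2 (invR a b c) (invX a b c)) * ddX a b c" for a b c
  have cV: "cont3 V"
    unfolding cont3_def V_def by (intro continuous_intros h_cont) (auto simp: invR_nonneg)
  have cD: "cont3 D"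
    unfolding cont3_def D_def f1R_def f1X_def f2R_def f2X_def
    by (intro continuous_intros h_cont) (auto simp: invR_nonneg)
  have "((\<lambda>t. V (cis t * a) b c) has_real_derivative D a b c) (at 0)" for a b c
  proof -
    note d = rotation_derivatives[of a b c]
    note hd = h_deriv[OF d(1) invR_nonneg]
    note fd = field_derivatives[OF d(1,2)]
    show ?thesis
      unfolding V_def
      by (rule DERIV_cong[OF DERIV_add[OF
          DERIV_mult[OF DERIV_diff[OF DERIV_mult[OF hd(1) fd(1)] DERIV_mult[OF hd(2) fd(3)]] d(3)]
          DERIV_mult[OF DERIV_diff[OF DERIV_mult[OF hd(1) fd(2)] DERIV_mult[OF hd(2) fd(4)]] d(4)]]])
        (simp add: D_def f1R_def f1X_def f2R_def f2X_def algebra_simps)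
  qed
  then have "mean3 D = 0"
    by (rule mean3_rotation_derivative[OF cV cD])
  \<comment> \<open>The cyclic sum of \<open>D\<close> is the full divergence; cyclic invariance of
    the mean supplies the two missing components.\<close>
  then have "0 = mean3 (\<lambda>a b c. D a b c + D b c a + D c a b)"
    using mean3_cyclic_sum[OF cD] by simp
  also have "\<dots> = mean3 (\<lambda>a b c. h0 (invR a b c) * kerG (invR a b c) (invX a b c) - h2 (invR a b c) * kerT (invR a b c) (invX a b c))"
  proof (rule mean3_cong)
    fix a b c :: complex assume unit: "cmod a = 1" "cmod b = 1" "cmod c = 1"
    have cyc: "invR b c a = invR a b c" "invR c a b = invR a b c" "invX b c a = invX a b c" "invX c a b = invX a b c"
      using inv_cyclic by metis+
    let ?r = "invR a b c" and ?x = "invX a b c"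
    have "D a b c + D b c a + D c a b =
      f1R ?r ?x * (dR a b c * dR a b c + dR b c a * dR b c a + dR c a b * dR c a b)
      + (f1X ?r ?x + f2R ?r ?x) * (dR a b c * dX a b c + dR b c a * dX b c a + dR c a b * dX c a b)
      + f2X ?r ?x * (dX a b c * dX a b c + dX b c a * dX b c a + dX c a b * dX c a b)
      + (h0 ?r * fA1 ?r ?x - h1 ?r * fB1 ?r ?x) * (ddR a b c + ddR b c a + ddR c a b)
      + (h0 ?r * fA2 ?r ?x - h1 ?r * fB2 ?r ?x) * (ddX a b c + ddX b c a + ddX c a b)"
      unfolding D_def cyc by (simp add: algebra_simps)
    also have "\<dots> = h0 ?r * kerG ?r ?x - h2 ?r * kerT ?r ?x"
      unfolding f1R_def f1X_def f2R_def f2X_def by (rule field_identity[OF gram[OF unit]])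
    finally show "D a b c + D b c a + D c a b = h0 ?r * kerG ?r ?x - h2 ?r * kerT ?r ?x" .
  qed
  also have "\<dots> = mean3 (\<lambda>a b c. h0 (invR a b c) * kerG (invR a b c) (invX a b c)) - mean3 (\<lambda>a b c. h2 (invR a b c) * kerT (invR a b c) (invX a b c))"
    by (rule mean3_diff; unfold cont3_def; intro continuous_intros h_cont) (auto simp: invR_nonneg)
  finally have "mean3 (\<lambda>a b c. h0 (invR a b c) * kerG (invR a b c) (invX a b c)) = mean3 (\<lambda>a b c. h2 (invR a b c) * kerT (invR a b c) (invX a b c))"
    by simp
  then show ?thesis
    unfolding h0_def h2_def using mean3_cmult[of "\<beta> * (\<beta> - 1)"] by (simp add: mult.assoc)
qed

text \<open>As \<open>c ^ 3 / (a * b)\<close> is the cube of the third coordinate, this is the real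
  inner product of \<open>phi\<close> with that monomial at a point of the torus.\<close>

definition testG :: "complex \<Rightarrow> complex \<Rightarrow> complex \<Rightarrow> real" where
  "testG a b c = Re ((a + b + c) * (a * b * cnj c ^ 3))"

lemma testG_bound:
  assumes unit: "cmod a = 1" "cmod b = 1" "cmod c = 1"
  shows "\<bar>testG a b c\<bar> \<le> 3"
proof -
  have "\<bar>testG a b c\<bar> \<le> cmod ((a + b + c) * (a * b * cnj c ^ 3))"
    unfolding testG_def by (rule abs_Re_le_cmod)
  also have "\<dots> = cmod (a + b + c)"
    using unit by (simp add: norm_mult norm_power)
  also have "\<dots> \<le> cmod a + cmod b + cmod c"
    by (meson norm_triangle_ineq norm_triangle_mono order_refl)
  finally show ?thesis using unit by simp
qed

text \<open>Since \<open>a * b * cnj c ^ 3\<close> equals \<open>e * cnj c ^ 4\<close>, the sum is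
  \<open>W * e\<close> times the fourth power sum of the conjugates, which Newton's identities
  express by \<open>W'\<close>, \<open>W\<close> and \<open>e'\<close>.\<close>

lemma testG_cyclic_sum:
  assumes unit: "cmod a = 1" "cmod b = 1" "cmod c = 1"
  shows "testG a b c + testG b c a + testG c a b = 3 * kerG (invR a b c) (invX a b c)"
proof -
  have uc: "a * cnj a = 1" "b * cnj b = 1" "c * cnj c = 1"
    using unit by (simp_all add: complex_norm_square[symmetric])
  define W e W' e' where "W = a + b + c" and "e = a * b * c" and "W' = cnj a + cnj b + cnj c"
    and "e' = cnj a * cnj b * cnj c"
  have ee': "e * e' = 1"
    unfolding e_def e'_def using uc by algebra
  have e2: "cnj a * cnj b + cnj b * cnj c + cnj c * cnj a = e' * W"
    unfolding e'_def W_def using uc by algebra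
  have m: "a * b * cnj c ^ 3 = e * cnj c ^ 4" "b * c * cnj a ^ 3 = e * cnj a ^ 4" "c * a * cnj b ^ 3 = e * cnj b ^ 4"
    unfolding e_def using uc by algebra+
  have p4: "cnj a ^ 4 + cnj b ^ 4 + cnj c ^ 4 = W' ^ 4 - 4 * W'\<^sup>2 * (e' * W) + 2 * (e' * W)\<^sup>2 + 4 * W' * e'"
    unfolding e2[symmetric] unfolding W'_def e'_def by algebra
  have "W * (a * b * cnj c ^ 3) + W * (b * c * cnj a ^ 3) + W * (c * a * cnj b ^ 3) = W * e * (cnj a ^ 4 + cnj b ^ 4 + cnj c ^ 4)"
    unfolding m by (simp add: algebra_simps)
  also have "\<dots> = (W * W') * (W' ^ 3 * e) - 4 * (e * e') * (W * W')\<^sup>2 + 2 * (e * e') * (W ^ 3 * e') + 4 * (e * e') * (W * W')"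
    unfolding p4 by (simp add: algebra_simps power2_eq_square power3_eq_cube power4_eq_xxxx)
  also have "W * W' = complex_of_real (invR a b c)"
    unfolding invR_def complex_norm_square by (simp add: W_def W'_def)
  finally have "W * (a * b * cnj c ^ 3) + W * (b * c * cnj a ^ 3) + W * (c * a * cnj b ^ 3) =
    complex_of_real (invR a b c) * (W' ^ 3 * e) - 4 * (complex_of_real (invR a b c))\<^sup>2 + 2 * (W ^ 3 * e') + 4 * complex_of_real (invR a b c)"
    by (simp add: ee')
  moreover have "Re (W' ^ 3 * e) = invX a b c" "Re (W ^ 3 * e') = invX a b c"
  proof -
    show "Re (W ^ 3 * e') = invX a b c"
      by (simp add: invX_def W_def e'_def)
    moreover have "W' ^ 3 * e = cnj (W ^ 3 * e')"
      by (simp add: W_def e_def W'_def e'_def)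
    ultimately show "Re (W' ^ 3 * e) = invX a b c"
      by (simp only: cnj.sel)
  qed
  moreover have "b + c + a = W" "c + a + b = W" "a + b + c = W"
    by (simp_all add: W_def)
  moreover have "Re (complex_of_real r * z - 4 * (complex_of_real r)\<^sup>2 + 2 * z' + 4 * complex_of_real r) =
      r * Re z - 4 * r\<^sup>2 + 2 * Re z' + 4 * r" for r z z'
    by (simp add: power2_eq_square)
  ultimately show ?thesis
    unfolding testG_def kerG_def plus_complex.sel[symmetric] by simp
qed

text \<open>The factor \<open>h (invR a b c)\<close> is cyclically invariant, so under the mean
  \<open>testG\<close> may be replaced by its cyclic average.\<close>

lemma mean3_testG:
  assumes "cont3 (\<lambda>a b c. h (invR a b c))"
  shows "mean3 (\<lambda>a b c. h (invR a b c) * testG a b c) = mean3 (\<lambda>a b c. h (invR a b c) * kerG (invR a b c) (invX a b c))"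
proof -
  have c1: "cont3 (\<lambda>a b c. h (invR a b c) * testG a b c)"
    using assms unfolding cont3_def testG_def by (intro continuous_intros)
  have "3 * mean3 (\<lambda>a b c. h (invR a b c) * testG a b c) = mean3 (\<lambda>a b c. 3 * (h (invR a b c) * kerG (invR a b c) (invX a b c)))"
    unfolding mean3_cyclic_sum[OF c1, symmetric]
  proof (rule mean3_cong)
    fix a b c :: complex assume unit: "cmod a = 1" "cmod b = 1" "cmod c = 1"
    have cyc: "invR b c a = invR a b c" "invR c a b = invR a b c"
      using inv_cyclic by metis+
    have "h (invR a b c) * testG a b c + h (invR b c a) * testG b c a + h (invR c a b) * testG c a b =
      h (invR a b c) * (testG a b c + testG b c a + testG c a b)"
      unfolding cyc by (simp add: distrib_left)
    then show "h (invR a b c) * testG a b c + h (invR b c a) * testG b c a + h (invR c a b) * testG c a b =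
      3 * (h (invR a b c) * kerG (invR a b c) (invX a b c))"
      unfolding testG_cyclic_sum[OF unit] by simp
  qed
  then show ?thesis
    unfolding mean3_cmult by simp
qed

text \<open>A nonnegative function of mean zero vanishes almost everywhere; by continuity and full
  support it then vanishes everywhere.\<close>

lemma mean3_pos:
  fixes F :: "complex \<Rightarrow> complex \<Rightarrow> complex \<Rightarrow> real"
  assumes F: "cont3 F" and nonneg: "\<And>a b c. cmod a = 1 \<Longrightarrow> cmod b = 1 \<Longrightarrow> cmod c = 1 \<Longrightarrow> 0 \<le> F a b c"
    and "cmod a = 1" "cmod b = 1" "cmod c = 1" "0 < F a b c"
  shows "0 < mean3 F"
proof (rule ccontr)
  have nn: "AE z in torus. 0 \<le> F (z (1::3) ^ 3) (z 2 ^ 3) (z 1 * z 2 * z 3)"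
    by (intro AE_I2 nonneg) (simp_all add: norm_mult norm_power)
  assume "\<not> 0 < mean3 F"
  moreover have "0 \<le> mean3 F"
    unfolding mean3_def using nn by (rule integral_nonneg_AE)
  ultimately have "AE z in torus. F (z (1::3) ^ 3) (z 2 ^ 3) (z 1 * z 2 * z 3) = 0"
    using integral_nonneg_eq_0_iff_AE[OF integrable_cont3[OF F] nn] by (simp add: mean3_def)
  then have "AE z in torus. F (z (1::3) ^ 3) (z 2 ^ 3) (z 1 * z 2 * z 3) \<le> 0"
    by eventually_elim simp
  then have "F a b c \<le> 0"
    by (rule torus3_full_support[OF F]) fact+
  with assms show False by simp
qed

lemma kerT_unit_nonneg:
  assumes "cmod a = 1" "cmod b = 1" "cmod c = 1"
  shows "0 \<le> kerT (invR a b c) (invX a b c)"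
  using kerT_nonneg[OF invR_nonneg invX_bound[OF assms] vandermonde_bound[OF assms]] .

lemma invR_le_9:
  assumes "cmod a = 1" "cmod b = 1" "cmod c = 1"
  shows "invR a b c \<le> 9"
proof -
  have "cmod (a + b + c) \<le> cmod a + cmod b + cmod c"
    by (meson norm_triangle_ineq norm_triangle_mono order_refl)
  then have "cmod (a + b + c) \<le> 3" using assms by simp
  from power_mono[OF this, of 2] show ?thesis
    by (simp add: invR_def)
qed

text \<open>Integration by parts turns the regularized mean into one of a nonnegative function. A
  positive lower bound that does not depend on \<open>\<epsilon>\<close> survives the limit.\<close>

lemma mean3_testG_pos:
  assumes \<beta>: "1 < \<beta>"
  shows "0 < mean3 (\<lambda>a b c. invR a b c powr \<beta> * testG a b c)"
proof -
  obtain k :: nat where k: "\<beta> - 2 \<le> real k"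
    using real_arch_simple by blast
  define p where "p = mean3 (\<lambda>a b c. invR a b c ^ k * kerT (invR a b c) (invX a b c))"
  have "0 < p"
    unfolding p_def
  proof (rule mean3_pos)
    show "cont3 (\<lambda>a b c. invR a b c ^ k * kerT (invR a b c) (invX a b c))"
      unfolding cont3_def by (intro continuous_intros)
    show "0 \<le> invR a b c ^ k * kerT (invR a b c) (invX a b c)" if "cmod a = 1" "cmod b = 1" "cmod c = 1" for a b c
      using kerT_unit_nonneg[OF that] by (simp add: invR_nonneg)
    \<comment> \<open>At this point \<open>kerT\<close> is \<open>308 / 108\<close>, and
      \<open>invR\<close> is nonzero, so the product is strictly positive.\<close>
    have "invR 1 1 \<i> = 5" "invX 1 1 \<i> = 11"
      by (simp_all add: invR_def invX_def cmod_power2 power3_eq_cube)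
    then show "0 < invR 1 1 \<i> ^ k * kerT (invR 1 1 \<i>) (invX 1 1 \<i>)"
      by (simp add: kerT_def)
  qed simp_all
  \<comment> \<open>The number 10 bounds \<open>invR + \<epsilon>\<close>, because
    \<open>invR\<close> is at most 9 and \<open>\<epsilon>\<close> at most 1.\<close>
  define m where "m = \<beta> * (\<beta> - 1) * (10 powr (\<beta> - 2) / 10 ^ k)"
  have "0 < m"
    using \<beta> by (simp add: m_def)
  have lower: "m * p \<le> mean3 (\<lambda>a b c. (invR a b c + \<epsilon>) powr \<beta> * testG a b c)" if \<epsilon>: "0 < \<epsilon>" "\<epsilon> \<le> 1" for \<epsilon>
  proof -
    have cont: "cont3 (\<lambda>a b c. (invR a b c + \<epsilon>) powr \<gamma>)" for \<gamma>
      unfolding cont3_def using \<epsilon> invR_nonneg by (intro continuous_intros ballI) (metis add_nonneg_pos less_irrefl)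
    have "m * p = \<beta> * (\<beta> - 1) * mean3 (\<lambda>a b c. 10 powr (\<beta> - 2) / 10 ^ k * (invR a b c ^ k * kerT (invR a b c) (invX a b c)))"
      unfolding m_def p_def mean3_cmult by simp
    also have "\<dots> \<le> \<beta> * (\<beta> - 1) * mean3 (\<lambda>a b c. (invR a b c + \<epsilon>) powr (\<beta> - 2) * kerT (invR a b c) (invX a b c))"
    proof (intro mult_left_mono mean3_mono)
      show "cont3 (\<lambda>a b c. 10 powr (\<beta> - 2) / 10 ^ k * (invR a b c ^ k * kerT (invR a b c) (invX a b c)))"
        unfolding cont3_def by (intro continuous_intros)
      show "cont3 (\<lambda>a b c. (invR a b c + \<epsilon>) powr (\<beta> - 2) * kerT (invR a b c) (invX a b c))"
        unfolding cont3_def by (rule continuous_on_mult[OF cont[unfolded cont3_def]]) (intro continuous_intros)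
      fix a b c :: complex assume unit: "cmod a = 1" "cmod b = 1" "cmod c = 1"
      let ?r = "invR a b c"
      have s: "0 < ?r + \<epsilon>" "?r + \<epsilon> \<le> 10"
        using invR_le_9[OF unit] invR_nonneg[of a b c] \<epsilon> by auto
      \<comment> \<open>After scaling, the base \<open>(?r + \<epsilon>) / 10\<close> lies below 1,
        so passing from the exponent \<open>k\<close> to the smaller \<open>\<beta> - 2\<close>
        increases the power, whether or not \<open>\<beta> - 2\<close> is negative.\<close>
      have "10 powr (\<beta> - 2) / 10 ^ k * ?r ^ k = 10 powr (\<beta> - 2) * (?r / 10) ^ k"
        by (simp add: power_divide)
      also have "\<dots> \<le> 10 powr (\<beta> - 2) * ((?r + \<epsilon>) / 10) ^ k"
        using \<epsilon> invR_nonneg by (intro mult_left_mono power_mono divide_right_mono) auto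
      also have "\<dots> = 10 powr (\<beta> - 2) * ((?r + \<epsilon>) / 10) powr real k"
        using s by (simp add: powr_realpow)
      also have "\<dots> \<le> 10 powr (\<beta> - 2) * ((?r + \<epsilon>) / 10) powr (\<beta> - 2)"
        using s k by (intro mult_left_mono powr_mono') auto
      also have "\<dots> = (?r + \<epsilon>) powr (\<beta> - 2)"
        using s by (simp add: powr_divide)
      finally have "10 powr (\<beta> - 2) / 10 ^ k * ?r ^ k \<le> (?r + \<epsilon>) powr (\<beta> - 2)" .
      from mult_right_mono[OF this kerT_unit_nonneg[OF unit]]
      show "10 powr (\<beta> - 2) / 10 ^ k * (?r ^ k * kerT ?r (invX a b c)) \<le> (?r + \<epsilon>) powr (\<beta> - 2) * kerT ?r (invX a b c)"
        by (simp add: mult.assoc)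
    qed (use \<beta> in auto)
    also have "\<dots> = mean3 (\<lambda>a b c. (invR a b c + \<epsilon>) powr \<beta> * testG a b c)"
      unfolding mean3_testG[OF cont] by (rule mean3_integration_by_parts[OF \<epsilon>(1), symmetric])
    finally show ?thesis .
  qed
  have "(\<lambda>n. mean3 (\<lambda>a b c. (invR a b c + inverse (real (Suc n))) powr \<beta> * testG a b c))
      \<longlonglongrightarrow> mean3 (\<lambda>a b c. invR a b c powr \<beta> * testG a b c)"
  proof (rule mean3_LIMSEQ[where C = "10 powr \<beta> * 3"])
    show "cont3 (\<lambda>a b c. (invR a b c + inverse (real (Suc n))) powr \<beta> * testG a b c)" for n
      unfolding cont3_def testG_def
      by (intro continuous_intros ballI less_imp_neq[symmetric] add_nonneg_pos invR_nonneg) simp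
    show "cont3 (\<lambda>a b c. invR a b c powr \<beta> * testG a b c)"
      unfolding cont3_def testG_def using \<beta>
      by (intro continuous_on_mult[OF continuous_on_powr'] continuous_intros ballI) (auto simp: invR_nonneg)
    fix a b c :: complex assume unit: "cmod a = 1" "cmod b = 1" "cmod c = 1"
    have "(\<lambda>n. (invR a b c + inverse (real (Suc n))) powr \<beta>) \<longlonglongrightarrow> (invR a b c + 0) powr \<beta>"
      using \<beta> invR_nonneg[of a b c]
      by (intro tendsto_powr' tendsto_add tendsto_const LIMSEQ_inverse_real_of_nat) (auto intro!: always_eventually add_nonneg_nonneg)
    then show "(\<lambda>n. (invR a b c + inverse (real (Suc n))) powr \<beta> * testG a b c) \<longlonglongrightarrow> invR a b c powr \<beta> * testG a b c"
      by (intro tendsto_mult tendsto_const) simp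
    fix n
    have "inverse (real (Suc n)) \<le> 1"
      by (simp add: inverse_le_1_iff)
    then have "(invR a b c + inverse (real (Suc n))) powr \<beta> \<le> 10 powr \<beta>"
      using \<beta> invR_le_9[OF unit] invR_nonneg[of a b c] by (intro powr_mono2) auto
    moreover note testG_bound[OF unit]
    ultimately show "norm ((invR a b c + inverse (real (Suc n))) powr \<beta> * testG a b c) \<le> 10 powr \<beta> * 3"
      by (auto simp: abs_mult intro!: mult_mono)
  qed
  then have "m * p \<le> mean3 (\<lambda>a b c. invR a b c powr \<beta> * testG a b c)"
    by (rule LIMSEQ_le_const) (auto intro!: exI[of _ 0] lower simp: inverse_le_1_iff)
  moreover have "0 < m * p"
    using \<open>0 < m\<close> \<open>0 < p\<close> by simp
  ultimately show ?thesis by linarith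
qed

section \<open>Monomials and Hardy spaces\<close>

text \<open>Convexity covers positive arguments. At zero the convention \<open>0 powr s = 0\<close>
  makes both boundary cases elementary.\<close>

lemma powr_above_tangent:
  fixes x y Q :: real
  assumes Q: "1 < Q" and "0 \<le> x" "0 \<le> y"
  shows "y powr Q + Q * y powr (Q - 1) * (x - y) \<le> x powr Q"
proof -
  consider "y = 0" | "x = 0" "0 < y" | "0 < x" "0 < y"
    using assms by fastforce
  then show ?thesis
  proof cases
    case 2
    have "y powr Q = y powr (Q - 1) * y"
      using 2 by (simp add: powr_diff)
    then show ?thesis
      using 2 Q by (simp add: mult_left_mono mult_ac)
  next
    case 3
    have "x powr Q - y powr Q \<ge> (Q * y powr (Q - 1)) * (x - y)"
    proof (rule convex_on_imp_above_tangent[of "{0<..}"])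
      show "convex_on {0<..} (\<lambda>x. x powr Q)"
        using Q by (intro powr_convex) simp
      show "((\<lambda>x. x powr Q) has_real_derivative Q * y powr (Q - 1)) (at y within {0<..})"
        using 3 by (intro has_real_derivative_powr has_field_derivative_at_within) auto
    qed (use 3 in \<open>auto simp: interior_open\<close>)
    then show ?thesis by simp
  qed (use Q in auto)
qed

section \<open>Monomials and Fourier coefficients on the torus\<close>

lemma measurable_cnj [measurable]: "cnj \<in> borel_measurable borel"
  by (intro borel_measurable_continuous_onI continuous_intros)

lemma measurable_monomial [measurable]: "monomial \<alpha> \<in> borel_measurable torus"
proof -
  have "(\<lambda>z. z i powi \<alpha> i) \<in> borel_measurable torus" for i
    by (cases "0 \<le> \<alpha> i") (simp_all add: power_int_def)
  then show ?thesis
    unfolding monomial_def[abs_def] by measurable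
qed

lemma cmod_monomial: "z \<in> space torus \<Longrightarrow> cmod (monomial \<alpha> z) = 1"
  by (simp add: monomial_def prod_norm[symmetric] norm_power_int)

lemma torus_nonzero: "z \<in> space torus \<Longrightarrow> z i \<noteq> 0"
  by (metis cmod_torus norm_zero zero_neq_one)

lemma monomial_mult_cnj:
  assumes "z \<in> space torus"
  shows "monomial \<alpha> z * cnj (monomial \<beta> z) = monomial (\<lambda>i. \<alpha> i - \<beta> i) z"
proof -
  have "cnj (z i) = inverse (z i)" for i
    using complex_norm_square[of "z i"] cmod_torus[OF assms] torus_nonzero[OF assms] by (simp add: field_simps)
  then show ?thesis
    using torus_nonzero[OF assms]
    by (simp add: monomial_def power_int_diff prod.distrib[symmetric] complex_cnj_power_int power_int_inverse divide_inverse)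
qed

text \<open>Rotating the coordinate \<open>i\<close> by the angle \<open>pi / \<alpha> i\<close>
  changes the sign of the monomial but not the integral.\<close>

lemma integral_monomial:
  assumes "\<alpha> i \<noteq> 0"
  shows "(LINT z|torus. monomial \<alpha> z) = 0"
proof -
  define u where "u j = (if j = i then cis (pi / of_int (\<alpha> i)) else 1)" for j
  have "monomial \<alpha> (\<lambda>j. u j * z j) = - monomial \<alpha> z" for z
  proof -
    have "monomial \<alpha> (\<lambda>j. u j * z j) = (\<Prod>j\<in>UNIV. u j powi \<alpha> j) * monomial \<alpha> z"
      by (simp add: monomial_def power_int_mult_distrib prod.distrib)
    also have "(\<Prod>j\<in>UNIV. u j powi \<alpha> j) = (\<Prod>j\<in>{i}. u j powi \<alpha> j)"
      by (rule prod.mono_neutral_right) (auto simp: u_def)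
    also have "\<dots> = -1"
      using assms by (simp add: u_def cis_power_int)
    finally show ?thesis by simp
  qed
  moreover have "(LINT z|torus. monomial \<alpha> (\<lambda>j. u j * z j)) = (LINT z|torus. monomial \<alpha> z)"
    by (rule integral_torus_rotation) (auto simp: u_def)
  ultimately show ?thesis
    by simp
qed

lemma fourier_coeff_monomial:
  assumes "\<alpha> \<noteq> \<beta>"
  shows "fourier_coeff (monomial \<alpha>) \<beta> = 0"
proof -
  obtain i where i: "\<alpha> i - \<beta> i \<noteq> 0"
    using assms by auto
  have "fourier_coeff (monomial \<alpha>) \<beta> = (LINT z|torus. monomial (\<lambda>i. \<alpha> i - \<beta> i) z)"
    unfolding fourier_coeff_def by (intro Bochner_Integration.integral_cong refl monomial_mult_cnj)
  then show ?thesis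
    using integral_monomial[of "\<lambda>i. \<alpha> i - \<beta> i", OF i] by simp
qed

lemma integrable_mult_bounded:
  fixes f g :: "('n::finite \<Rightarrow> complex) \<Rightarrow> complex"
  assumes "integrable torus f" "g \<in> borel_measurable torus" "\<And>z. z \<in> space torus \<Longrightarrow> cmod (g z) \<le> C"
  shows "integrable torus (\<lambda>z. f z * g z)"
proof (rule Bochner_Integration.integrable_bound)
  show "integrable torus (\<lambda>z. of_real C * f z)"
    using assms(1) by simp
  show "AE z in torus. norm (f z * g z) \<le> norm (of_real C * f z)"
  proof (rule AE_I2)
    fix z :: "'n \<Rightarrow> complex" assume "z \<in> space torus"
    then have "cmod (g z) \<le> \<bar>C\<bar>"
      using assms(3)[of z] by linarith
    then show "norm (f z * g z) \<le> norm (of_real C * f z)"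
      using mult_left_mono[of "cmod (g z)" "\<bar>C\<bar>" "cmod (f z)"] by (simp add: norm_mult mult.commute)
  qed
qed (use assms in auto)

lemma fourier_coeff_add:
  assumes "integrable torus f" "integrable torus g"
  shows "fourier_coeff (\<lambda>z. f z + g z) \<alpha> = fourier_coeff f \<alpha> + fourier_coeff g \<alpha>"
proof -
  have "integrable torus (\<lambda>z. h z * cnj (monomial \<alpha> z))" if "integrable torus h" for h
    by (rule integrable_mult_bounded[OF that, where C=1]) (simp_all add: cmod_monomial, measurable)
  from this[OF assms(1)] this[OF assms(2)] show ?thesis
    by (simp add: fourier_coeff_def distrib_right)
qed

lemma fourier_coeff_cmult: "fourier_coeff (\<lambda>z. k * f z) \<alpha> = k * fourier_coeff f \<alpha>"
  by (simp add: fourier_coeff_def mult.assoc)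

lemma bounded_in_Lp:
  assumes f: "f \<in> borel_measurable torus" and C: "\<And>z. z \<in> space torus \<Longrightarrow> cmod (f z) \<le> C"
  shows "f \<in> Lp p"
proof (cases "p = \<infinity>")
  case True
  have "esssup torus (\<lambda>z. ennreal (cmod (f z))) \<le> ennreal C"
    using f C by (intro esssup_I) (auto intro!: AE_I2 ennreal_leI)
  also have "\<dots> < \<infinity>" by simp
  finally show ?thesis
    using True f by (simp add: Lp_def)
next
  case False
  have "integrable torus (\<lambda>z. cmod (f z) powr enn2real p)"
    using f C by (intro torus.integrable_const_bound[where B="C powr enn2real p"]) (auto intro!: AE_I2 powr_mono2)
  then show ?thesis
    using False f by (simp add: Lp_def)
qed

section \<open>Three variables: \<open>phi\<close> and the competing monomial\<close>

definition mono3 :: "int \<Rightarrow> int \<Rightarrow> int \<Rightarrow> 3 \<Rightarrow> int" where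
  "mono3 i j k n = (if n = 1 then i else if n = 2 then j else k)"

lemma mono3_simps [simp]: "mono3 i j k 1 = i" "mono3 i j k 2 = j" "mono3 i j k 3 = k"
  by (simp_all add: mono3_def)

lemma mono3_eq_iff: "mono3 i j k = mono3 i' j' k' \<longleftrightarrow> i = i' \<and> j = j' \<and> k = k'"
  by (metis mono3_simps)

lemma monomial_mono3: "monomial (mono3 i j k) z = z 1 powi i * z 2 powi j * z 3 powi k"
proof -
  have "(1::3) \<noteq> 2" "(1::3) \<noteq> 3" "(2::3) \<noteq> 3" by simp_all
  then show ?thesis
    unfolding monomial_def UNIV_3 by (simp add: mult.assoc)
qed

lemma mono3_nonneg_iff: "(\<forall>n. 0 \<le> mono3 i j k n) \<longleftrightarrow> 0 \<le> i \<and> 0 \<le> j \<and> 0 \<le> k"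
  by (simp add: forall_3)

lemma phi_monomials: "phi = (\<lambda>z. monomial (mono3 3 0 0) z + (monomial (mono3 0 3 0) z + monomial (mono3 1 1 1) z))"
  by (rule ext) (simp add: phi_def monomial_mono3)

lemma integrable_monomial: "integrable torus (monomial \<alpha>)"
  by (rule torus.integrable_const_bound[where B=1]) (auto simp: cmod_monomial)

lemma fourier_coeff_phi:
  "fourier_coeff phi \<alpha> = fourier_coeff (monomial (mono3 3 0 0)) \<alpha>
    + (fourier_coeff (monomial (mono3 0 3 0)) \<alpha> + fourier_coeff (monomial (mono3 1 1 1)) \<alpha>)"
  unfolding phi_monomials
  by (subst fourier_coeff_add, (intro integrable_monomial Bochner_Integration.integrable_add)+)+ simp

lemma measurable_phi [measurable]: "phi \<in> borel_measurable torus"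
  unfolding phi_monomials by measurable

lemma phi_abc: "phi z = z 1 ^ 3 + z 2 ^ 3 + z 1 * z 2 * z 3"
  by (simp add: phi_def)

lemma cmod_phi_le:
  assumes "z \<in> space torus"
  shows "cmod (phi z) \<le> 3"
proof -
  have "cmod (phi z) \<le> cmod (z 1 ^ 3) + cmod (z 2 ^ 3) + cmod (z 1 * z 2 * z 3)"
    unfolding phi_def by (meson norm_triangle_ineq norm_triangle_mono order_refl)
  then show ?thesis
    using assms by (simp add: norm_mult norm_power)
qed

lemma phi_in_Hardy: "phi \<in> Hardy p"
proof -
  have "fourier_coeff phi \<alpha> = 0" if "\<not> (\<forall>i. 0 \<le> \<alpha> i)" for \<alpha>
  proof -
    have "mono3 3 0 0 \<noteq> \<alpha>" "mono3 0 3 0 \<noteq> \<alpha>" "mono3 1 1 1 \<noteq> \<alpha>"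
      using that mono3_nonneg_iff[of 3 0 0] mono3_nonneg_iff[of 0 3 0] mono3_nonneg_iff[of 1 1 1] by auto
    then show ?thesis
      by (simp add: fourier_coeff_phi fourier_coeff_monomial)
  qed
  then show ?thesis
    using bounded_in_Lp[OF measurable_phi cmod_phi_le] by (simp add: Hardy_def)
qed

text \<open>The value 3 is attained at \<open>a = b = c = 1\<close>, and full support makes it the
  essential supremum. This serves both nontriviality and the exponent infinity.\<close>

lemma AE_cmod_phi_imp_3_le:
  assumes "AE z in torus. cmod (phi z) \<le> m"
  shows "3 \<le> m"
proof -
  have "AE z in torus. (\<lambda>a b c. cmod (a + b + c)) (z (1::3) ^ 3) (z 2 ^ 3) (z 1 * z 2 * z 3) \<le> m"
    using assms by (simp add: phi_abc)
  from torus3_full_support[OF _ this, of 1 1 1] show ?thesis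
    by (simp add: cont3_def continuous_intros)
qed

lemma phi_nontrivial: "\<not> (AE z in torus. phi z = 0)"
proof
  assume "AE z in torus. phi z = 0"
  then have "AE z in torus. cmod (phi z) \<le> 0"
    by eventually_elim simp
  from AE_cmod_phi_imp_3_le[OF this] show False by simp
qed

lemma scaled_z3_in_Hardy: "(\<lambda>z. k * z (3::3) ^ 3) \<in> Hardy p"
proof -
  have eq: "(\<lambda>z. k * z (3::3) ^ 3) = (\<lambda>z. k * monomial (mono3 0 0 3) z)"
    by (simp add: monomial_mono3)
  have "fourier_coeff (\<lambda>z. k * monomial (mono3 0 0 3) z) \<alpha> = 0" if "\<not> (\<forall>i. 0 \<le> \<alpha> i)" for \<alpha>
  proof -
    have "mono3 0 0 3 \<noteq> \<alpha>"
      using that mono3_nonneg_iff[of 0 0 3] by auto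
    then show ?thesis
      by (simp add: fourier_coeff_cmult fourier_coeff_monomial)
  qed
  moreover have "(\<lambda>z. k * monomial (mono3 0 0 3) z) \<in> Lp p"
    by (rule bounded_in_Lp[where C="cmod k"]) (auto simp: norm_mult cmod_monomial)
  ultimately show ?thesis
    unfolding eq by (simp add: Hardy_def)
qed

lemma torus_inner_z3_phi: "torus_inner (\<lambda>z. k * z (3::3) ^ 3) phi = 0"
proof -
  have "fourier_coeff phi (mono3 0 0 3) = 0"
    by (simp add: fourier_coeff_phi fourier_coeff_monomial mono3_eq_iff)
  then have "(LINT z|torus. cnj (phi z * cnj (monomial (mono3 0 0 3) z))) = 0"
    by (simp add: fourier_coeff_def del: complex_cnj_mult)
  then have "(LINT z|torus. z 3 ^ 3 * cnj (phi z)) = 0"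
    by (simp add: monomial_mono3 mult.commute)
  then show ?thesis
    by (simp add: torus_inner_def mult.assoc)
qed

section \<open>Hilbert points\<close>

lemma power2_powr: "0 \<le> x \<Longrightarrow> (x\<^sup>2) powr s = x powr (2 * s)" for x s :: real
  by (cases "x = 0") (simp_all add: powr_powr flip: powr_numeral)

text \<open>The hypothesis \<open>above\<close> bounds the power of the norm below by its tangent at
  \<open>phi\<close>, and \<open>orth\<close> says that the linear term of this tangent integrates
  to zero for every admissible \<open>f\<close>.\<close>

lemma hilbert_point_phi_nat:
  fixes n :: nat
  assumes n: "2 \<le> n" and p: "p \<noteq> \<infinity>" "enn2real p = real n"
    and above: "\<And>u v. cmod u ^ n + real n * (cmod u ^ (n - 2) * Re (v * cnj u)) \<le> cmod (u + v) ^ n"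
    and orth: "\<And>f. f \<in> Hardy p \<Longrightarrow> torus_inner f phi = 0 \<Longrightarrow> integrable torus f \<Longrightarrow>
      (LINT z|torus. f z * (of_real (cmod (phi z) ^ (n - 2)) * cnj (phi z))) = 0"
  shows "hilbert_point p phi"
  unfolding hilbert_point_def
proof (intro conjI ballI impI)
  show "phi \<in> Hardy p" by (rule phi_in_Hardy)
  show "\<not> (AE z in torus. phi z = 0)" by (rule phi_nontrivial)
  fix f :: "(3 \<Rightarrow> complex) \<Rightarrow> complex" assume f: "f \<in> Hardy p" and inner: "torus_inner f phi = 0"
  have powr: "x powr enn2real p = x ^ n" if "0 \<le> x" for x
    unfolding p(2) using that n by (intro powr_realpow') auto
  have [measurable]: "f \<in> borel_measurable torus" and fn: "integrable torus (\<lambda>z. cmod (f z) ^ n)"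
    using f p(1) by (simp_all add: Hardy_def Lp_def powr)
  have fint: "integrable torus f"
  proof (rule Bochner_Integration.integrable_bound)
    show "integrable torus (\<lambda>z. 1 + cmod (f z) ^ n)" using fn by simp
    have "x \<le> 1 + x ^ n" if "0 \<le> x" for x :: real
    proof (cases "x \<le> 1")
      case False
      then have "x \<le> x ^ n" using n by (intro self_le_power) auto
      then show ?thesis by simp
    qed (use that in \<open>simp add: add_increasing2\<close>)
    then show "AE z in torus. norm (f z) \<le> norm (1 + cmod (f z) ^ n)"
      by (intro AE_I2) (simp add: abs_of_nonneg)
  qed simp
  have pn: "integrable torus (\<lambda>z. cmod (phi z) ^ n)"
    by (rule torus.integrable_const_bound[where B="3 ^ n"]) (auto intro!: AE_I2 power_mono cmod_phi_le)
  have sn: "integrable torus (\<lambda>z. cmod (phi z + f z) ^ n)"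
  proof (rule Bochner_Integration.integrable_bound)
    show "integrable torus (\<lambda>z. 2 ^ n * (cmod (phi z) ^ n + cmod (f z) ^ n))" using fn pn by simp
    have "cmod (u + v) ^ n \<le> 2 ^ n * (cmod u ^ n + cmod v ^ n)" for u v
    proof -
      have "cmod (u + v) \<le> 2 * max (cmod u) (cmod v)"
        using norm_triangle_ineq[of u v] by linarith
      then have "cmod (u + v) ^ n \<le> (2 * max (cmod u) (cmod v)) ^ n"
        by (intro power_mono) auto
      also have "\<dots> \<le> 2 ^ n * (cmod u ^ n + cmod v ^ n)"
        by (auto simp: power_mult_distrib max_def)
      finally show ?thesis .
    qed
    then show "AE z in torus. norm (cmod (phi z + f z) ^ n) \<le> norm (2 ^ n * (cmod (phi z) ^ n + cmod (f z) ^ n))"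
      by (intro AE_I2) simp
  qed simp
  \<comment> \<open>The real part of \<open>?K\<close>, times \<open>n\<close>, is the first-order
    term of \<open>cmod (phi z + f z) ^ n\<close> in \<open>f\<close>.\<close>
  let ?K = "\<lambda>z. f z * (of_real (cmod (phi z) ^ (n - 2)) * cnj (phi z))"
  have K: "integrable torus ?K"
    by (rule integrable_mult_bounded[OF fint, where C="3 ^ (n - 2) * 3"])
      (auto simp: norm_mult norm_power intro!: mult_mono power_mono cmod_phi_le)
  have "(LINT z|torus. Re (?K z)) = 0"
    using integral_Re[OF K] orth[OF f inner fint] by simp
  then have "(LINT z|torus. cmod (phi z) ^ n) = (LINT z|torus. cmod (phi z) ^ n + real n * Re (?K z))"
    using pn integrable_Re[OF K] by simp
  also have "\<dots> \<le> (LINT z|torus. cmod (phi z + f z) ^ n)"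
  proof (rule integral_mono)
    show "integrable torus (\<lambda>z. cmod (phi z) ^ n + real n * Re (?K z))"
      using pn integrable_Re[OF K] by simp
    fix z
    have "?K z = of_real (cmod (phi z) ^ (n - 2)) * (f z * cnj (phi z))"
      by (simp only: mult_ac)
    then have "Re (?K z) = cmod (phi z) ^ (n - 2) * Re (f z * cnj (phi z))"
      by (simp only: Re_complex_of_real Im_complex_of_real times_complex.sel mult_zero_left diff_zero)
    then show "cmod (phi z) ^ n + real n * Re (?K z) \<le> cmod (phi z + f z) ^ n"
      using above[of "phi z" "f z"] by simp
  qed (rule sn)
  finally show "Lp_norm p phi \<le> Lp_norm p (\<lambda>z. phi z + f z)"
    using p(1) by (simp add: Lp_norm_def powr powr_mono2 integral_nonneg_AE)
qed

section \<open>The exponents 2 and 4\<close>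

lemma hilbert_point_2_phi: "hilbert_point 2 phi"
proof (rule hilbert_point_phi_nat[where n=2])
  show "cmod u ^ 2 + real 2 * (cmod u ^ (2 - 2) * Re (v * cnj u)) \<le> cmod (u + v) ^ 2" for u v
    by (simp add: cmod_power2) (simp add: power2_eq_square algebra_simps)
qed (simp_all add: torus_inner_def)

text \<open>Cauchy-Schwarz reduces this to the tangent inequality for the fourth power of the two
  moduli, where the defect factors with \<open>(y - x)\<^sup>2\<close>.\<close>

lemma cmod_power4_above_tangent:
  "cmod u ^ 4 + 4 * (cmod u ^ 2 * Re (v * cnj u)) \<le> cmod (u + v) ^ 4"
proof -
  have "Re ((u + v) * cnj u) \<le> cmod (u + v) * cmod u"
    using complex_Re_le_cmod[of "(u + v) * cnj u"] by (simp add: norm_mult)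
  moreover have "Re ((u + v) * cnj u) = cmod u ^ 2 + Re (v * cnj u)"
    by (simp add: cmod_power2 distrib_right) (simp add: power2_eq_square)
  ultimately have "Re (v * cnj u) \<le> cmod (u + v) * cmod u - cmod u ^ 2"
    by simp
  then have "cmod u ^ 2 * Re (v * cnj u) \<le> cmod u ^ 2 * (cmod (u + v) * cmod u - cmod u ^ 2)"
    by (intro mult_left_mono) auto
  moreover have "y ^ 4 - (x ^ 4 + 4 * (x ^ 2 * (y * x - x ^ 2))) = (y - x)\<^sup>2 * ((y + x)\<^sup>2 + 2 * x\<^sup>2)" for x y :: real
    by algebra
  then have "x ^ 4 + 4 * (x ^ 2 * (y * x - x ^ 2)) \<le> y ^ 4" for x y :: real
    by (smt (verit) mult_nonneg_nonneg zero_le_power2)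
  ultimately show ?thesis
    by (smt (verit))
qed

text \<open>In the expansion of \<open>(a + b + c)\<^sup>2 * (a' + b' + c')\<close> the monomial
  \<open>a\<close> appears once from \<open>a * a * a'\<close> and twice each from
  \<open>a * b * b'\<close> and \<open>a * c * c'\<close>, whence the factor 5. Each of the nine
  other monomials has a negative exponent.\<close>

lemma phi_cube:
  assumes z: "z \<in> space torus"
  shows "of_real (cmod (phi z) ^ 2) * phi z = 5 * phi z
    + (monomial (mono3 6 (-3) 0) z + monomial (mono3 5 (-1) (-1)) z + monomial (mono3 (-3) 6 0) z
      + monomial (mono3 (-1) 5 (-1)) z + monomial (mono3 (-1) 2 2) z + monomial (mono3 2 (-1) 2) z
      + 2 * (monomial (mono3 2 2 (-1)) z + monomial (mono3 4 (-2) 1) z + monomial (mono3 (-2) 4 1) z))"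
proof -
  define a b c a' b' c' where "a = z 1 ^ 3" and "b = z 2 ^ 3" and "c = z 1 * z 2 * z 3"
    and "a' = inverse a" and "b' = inverse b" and "c' = inverse c"
  have nz: "z 1 \<noteq> 0" "z 2 \<noteq> 0" "z 3 \<noteq> 0"
    using torus_nonzero[OF z] by auto
  have cnj: "cnj (z i) = inverse (z i)" for i
    using complex_norm_square[of "z i"] cmod_torus[OF z] torus_nonzero[OF z] by (simp add: field_simps)
  have abc: "a * a' = 1" "b * b' = 1" "c * c' = 1"
    using nz unfolding a_def b_def c_def a'_def b'_def c'_def by (intro right_inverse; simp)+
  have "cnj (phi z) = a' + b' + c'"
    by (simp add: phi_def cnj a_def b_def c_def a'_def b'_def c'_def power_inverse)
  then have "of_real (cmod (phi z) ^ 2) * phi z = (a + b + c) * (a' + b' + c') * (a + b + c)"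
    unfolding complex_norm_square by (simp add: phi_def a_def b_def c_def)
  also have "\<dots> = 5 * (a + b + c) + (a\<^sup>2 * b' + a\<^sup>2 * c' + b\<^sup>2 * a' + b\<^sup>2 * c' + c\<^sup>2 * a' + c\<^sup>2 * b'
      + 2 * (a * b * c' + a * c * b' + b * c * a'))"
    using abc by algebra
  also have "a\<^sup>2 * b' = monomial (mono3 6 (-3) 0) z"
    using nz by (simp add: monomial_mono3 a_def b'_def b_def power_int_minus)
  also have "a\<^sup>2 * c' = monomial (mono3 5 (-1) (-1)) z"
    using nz by (simp add: monomial_mono3 a_def c'_def c_def power_int_minus field_simps eval_nat_numeral)
  also have "b\<^sup>2 * a' = monomial (mono3 (-3) 6 0) z"
    using nz by (simp add: monomial_mono3 a_def a'_def b_def power_int_minus)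
  also have "b\<^sup>2 * c' = monomial (mono3 (-1) 5 (-1)) z"
    using nz by (simp add: monomial_mono3 b_def c'_def c_def power_int_minus field_simps eval_nat_numeral)
  also have "c\<^sup>2 * a' = monomial (mono3 (-1) 2 2) z"
    using nz by (simp add: monomial_mono3 a_def a'_def c_def power_int_minus field_simps eval_nat_numeral)
  also have "c\<^sup>2 * b' = monomial (mono3 2 (-1) 2) z"
    using nz by (simp add: monomial_mono3 b_def b'_def c_def power_int_minus field_simps eval_nat_numeral)
  also have "a * b * c' = monomial (mono3 2 2 (-1)) z"
    using nz by (simp add: monomial_mono3 a_def b_def c'_def c_def power_int_minus field_simps eval_nat_numeral)
  also have "a * c * b' = monomial (mono3 4 (-2) 1) z"
    using nz by (simp add: monomial_mono3 a_def b_def b'_def c_def power_int_minus field_simps eval_nat_numeral)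
  also have "b * c * a' = monomial (mono3 (-2) 4 1) z"
    using nz by (simp add: monomial_mono3 a_def b_def a'_def c_def power_int_minus field_simps eval_nat_numeral)
  also have "a + b + c = phi z"
    by (simp add: phi_def a_def b_def c_def)
  finally show ?thesis .
qed

lemma hilbert_point_4_phi: "hilbert_point 4 phi"
proof (rule hilbert_point_phi_nat[where n=4])
  show "cmod u ^ 4 + real 4 * (cmod u ^ (4 - 2) * Re (v * cnj u)) \<le> cmod (u + v) ^ 4" for u v
    using cmod_power4_above_tangent[of u v] by simp
  fix f :: "(3 \<Rightarrow> complex) \<Rightarrow> complex" assume f: "f \<in> Hardy 4" and inner: "torus_inner f phi = 0" and fint: "integrable torus f"
  have int: "integrable torus (\<lambda>z. f z * cnj (monomial \<alpha> z))" for \<alpha>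
    by (rule integrable_mult_bounded[OF fint, where C=1]) (simp_all add: cmod_monomial, measurable)
  have intphi: "integrable torus (\<lambda>z. f z * cnj (phi z))"
    by (rule integrable_mult_bounded[OF fint, where C=3]) (simp_all add: cmod_phi_le, measurable)
  \<comment> \<open>Membership in the Hardy space removes the monomials with a negative exponent;
    the remaining multiple of \<open>phi\<close> is removed by \<open>inner\<close>.\<close>
  have zero: "(LINT z|torus. f z * cnj (monomial (mono3 i j k) z)) = 0" if "i < 0 \<or> j < 0 \<or> k < 0" for i j k
    using f that mono3_nonneg_iff[of i j k] by (auto simp: Hardy_def fourier_coeff_def)
  have "(LINT z|torus. f z * (of_real (cmod (phi z) ^ (4 - 2)) * cnj (phi z))) =
    (LINT z|torus. 5 * (f z * cnj (phi z))
    + (f z * cnj (monomial (mono3 6 (-3) 0) z) + f z * cnj (monomial (mono3 5 (-1) (-1)) z) + f z * cnj (monomial (mono3 (-3) 6 0) z)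
      + f z * cnj (monomial (mono3 (-1) 5 (-1)) z) + f z * cnj (monomial (mono3 (-1) 2 2) z) + f z * cnj (monomial (mono3 2 (-1) 2) z)
      + 2 * (f z * cnj (monomial (mono3 2 2 (-1)) z) + f z * cnj (monomial (mono3 4 (-2) 1) z) + f z * cnj (monomial (mono3 (-2) 4 1) z))))"
  proof (rule Bochner_Integration.integral_cong[OF refl])
    fix z :: "3 \<Rightarrow> complex" assume "z \<in> space torus"
    have "f z * (of_real (cmod (phi z) ^ (4 - 2)) * cnj (phi z)) = f z * cnj (of_real (cmod (phi z) ^ 2) * phi z)"
      by simp
    also have "\<dots> = 5 * (f z * cnj (phi z))
    + (f z * cnj (monomial (mono3 6 (-3) 0) z) + f z * cnj (monomial (mono3 5 (-1) (-1)) z) + f z * cnj (monomial (mono3 (-3) 6 0) z)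
      + f z * cnj (monomial (mono3 (-1) 5 (-1)) z) + f z * cnj (monomial (mono3 (-1) 2 2) z) + f z * cnj (monomial (mono3 2 (-1) 2) z)
      + 2 * (f z * cnj (monomial (mono3 2 2 (-1)) z) + f z * cnj (monomial (mono3 4 (-2) 1) z) + f z * cnj (monomial (mono3 (-2) 4 1) z)))"
      unfolding phi_cube[OF \<open>z \<in> space torus\<close>] complex_cnj_add complex_cnj_mult complex_cnj_numeral by algebra
    finally show "f z * (of_real (cmod (phi z) ^ (4 - 2)) * cnj (phi z)) = \<dots>" .
  qed
  also have "\<dots> = 0"
    using inner by (simp add: int intphi zero torus_inner_def)
  finally show "(LINT z|torus. f z * (of_real (cmod (phi z) ^ (4 - 2)) * cnj (phi z))) = 0" .
qed simp_all

section \<open>The exponents above 4\<close>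

definition perturbed :: "real \<Rightarrow> complex \<Rightarrow> complex \<Rightarrow> complex \<Rightarrow> real" where
  "perturbed \<epsilon> a b c = (cmod (a + b + c - of_real \<epsilon> * (c ^ 3 * cnj (a * b))))\<^sup>2"

lemma perturbed_eq:
  assumes unit: "cmod a = 1" "cmod b = 1" "cmod c = 1"
  shows "perturbed \<epsilon> a b c = invR a b c - 2 * \<epsilon> * testG a b c + \<epsilon>\<^sup>2"
proof -
  define w d where "w = a + b + c" and "d = c ^ 3 * cnj (a * b)"
  have d: "cmod d = 1"
    using unit by (simp add: d_def norm_mult norm_power)
  have "(cmod (w - of_real \<epsilon> * d))\<^sup>2 = (cmod w)\<^sup>2 - 2 * \<epsilon> * Re (w * cnj d) + \<epsilon>\<^sup>2 * (cmod d)\<^sup>2"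
    unfolding cmod_power2 by (simp add: algebra_simps power2_eq_square)
  moreover have "Re (w * cnj d) = testG a b c"
    by (simp add: testG_def w_def d_def mult_ac)
  ultimately show ?thesis
    by (simp add: perturbed_def invR_def w_def d_def[symmetric] d del: complex_cnj_mult)
qed

lemma perturbed_nonneg: "0 \<le> perturbed \<epsilon> a b c"
  by (simp add: perturbed_def)

lemma perturbed_torus:
  assumes "z \<in> space torus"
  shows "perturbed \<epsilon> (z 1 ^ 3) (z 2 ^ 3) (z 1 * z 2 * z (3::3)) = (cmod (phi z + (- of_real \<epsilon>) * z 3 ^ 3))\<^sup>2"
proof -
  have u: "z i * cnj (z i) = 1" for i
    using assms by (simp add: complex_norm_square[symmetric])
  have "(z 1 * z 2 * z 3) ^ 3 * cnj (z 1 ^ 3 * z 2 ^ 3) = (z 1 * cnj (z 1)) ^ 3 * (z 2 * cnj (z 2)) ^ 3 * z 3 ^ 3"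
    by (simp add: power_mult_distrib mult_ac)
  then have "(z 1 * z 2 * z 3) ^ 3 * cnj (z 1 ^ 3 * z 2 ^ 3) = z 3 ^ 3"
    by (simp add: u)
  then show ?thesis
    unfolding perturbed_def by (simp add: phi_def del: complex_cnj_mult)
qed

text \<open>If subtracting a small multiple of the cubed third coordinate never lowered the norm,
  the first-order term would have the wrong sign, against \<open>mean3_testG_pos\<close> with
  \<open>\<beta> = Q - 1\<close>.\<close>

lemma not_hilbert_point_finite:
  assumes q: "4 < q"
  shows "\<not> hilbert_point (ennreal q) phi"
proof
  assume hp: "hilbert_point (ennreal q) phi"
  define Q where "Q = q / 2"
  have Q: "2 < Q" and qQ: "q = 2 * Q"
    using q by (simp_all add: Q_def)
  \<comment> \<open>\<open>Q * \<epsilon> * H \<epsilon>\<close> is the linear term of the tangent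
    at the perturbed value. With the tangent taken there, each fixed \<open>\<epsilon>\<close>
    yields an exact inequality, and no derivative of the norm is required.\<close>
  define H where "H \<epsilon> a b c = perturbed \<epsilon> a b c powr (Q - 1) * (2 * testG a b c - \<epsilon>)" for \<epsilon> a b c
  have cperturbed: "continuous_on UNIV (\<lambda>p. perturbed \<epsilon> (fst p) (fst (snd p)) (snd (snd p)) powr s)" if "0 < s" for \<epsilon> s
    unfolding perturbed_def
    by (intro continuous_on_powr' continuous_intros ballI) (use that in auto)
  have cR: "continuous_on UNIV (\<lambda>p. invR (fst p) (fst (snd p)) (snd (snd p)) powr s)" if "0 < s" for s
    by (intro continuous_on_powr' continuous_intros ballI) (use that in \<open>auto simp: invR_nonneg\<close>)
  have cG: "continuous_on UNIV (\<lambda>p. testG (fst p) (fst (snd p)) (snd (snd p)))"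
    unfolding testG_def by (intro continuous_intros)
  have cH: "cont3 (H \<epsilon>)" for \<epsilon>
    unfolding cont3_def H_def using Q by (intro continuous_on_mult cperturbed continuous_intros cG) simp
  have le: "mean3 (H \<epsilon>) \<le> 0" if \<epsilon>: "0 < \<epsilon>" for \<epsilon>
  proof -
    let ?f = "\<lambda>z. (- of_real \<epsilon>) * z (3::3) ^ 3"
    have "Lp_norm (ennreal q) phi \<le> Lp_norm (ennreal q) (\<lambda>z. phi z + ?f z)"
      using hp scaled_z3_in_Hardy torus_inner_z3_phi unfolding hilbert_point_def by blast
    then have "(LINT z|torus. cmod (phi z) powr q) powr (1 / q) \<le> (LINT z|torus. cmod (phi z + ?f z) powr q) powr (1 / q)"
      using q by (simp add: Lp_norm_def)
    then have "(LINT z|torus. cmod (phi z) powr q) \<le> (LINT z|torus. cmod (phi z + ?f z) powr q)"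
      using powr_less_mono2[of "1 / q" "LINT z|torus. cmod (phi z + ?f z) powr q" "LINT z|torus. cmod (phi z) powr q"] q
      by (simp add: integral_nonneg_AE) (meson integral_nonneg_AE AE_I2 not_less powr_ge_zero)
    also have "(LINT z|torus. cmod (phi z) powr q) = mean3 (\<lambda>a b c. invR a b c powr Q)"
      unfolding mean3_def invR_def qQ by (simp add: power2_powr phi_abc)
    also have "(LINT z|torus. cmod (phi z + ?f z) powr q) = mean3 (\<lambda>a b c. perturbed \<epsilon> a b c powr Q)"
      unfolding mean3_def qQ
      by (intro Bochner_Integration.integral_cong refl) (simp only: perturbed_torus power2_powr norm_ge_zero)
    also have "\<dots> \<le> mean3 (\<lambda>a b c. invR a b c powr Q - (Q * \<epsilon>) * H \<epsilon> a b c)"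
    proof (rule mean3_mono)
      show "cont3 (\<lambda>a b c. perturbed \<epsilon> a b c powr Q)"
        unfolding cont3_def using Q by (intro cperturbed) simp
      show "cont3 (\<lambda>a b c. invR a b c powr Q - (Q * \<epsilon>) * H \<epsilon> a b c)"
        using cH[of \<epsilon>] Q unfolding cont3_def by (intro continuous_on_diff cR continuous_on_mult continuous_intros) auto
      fix a b c :: complex assume unit: "cmod a = 1" "cmod b = 1" "cmod c = 1"
      have "perturbed \<epsilon> a b c powr Q + Q * perturbed \<epsilon> a b c powr (Q - 1) * (invR a b c - perturbed \<epsilon> a b c) \<le> invR a b c powr Q"
        using Q by (intro powr_above_tangent) (auto simp: invR_nonneg perturbed_nonneg)
      moreover have "invR a b c - perturbed \<epsilon> a b c = \<epsilon> * (2 * testG a b c - \<epsilon>)"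
        unfolding perturbed_eq[OF unit] by (simp add: algebra_simps power2_eq_square)
      ultimately show "perturbed \<epsilon> a b c powr Q \<le> invR a b c powr Q - (Q * \<epsilon>) * H \<epsilon> a b c"
        by (simp add: H_def mult_ac)
    qed
    also have "\<dots> = mean3 (\<lambda>a b c. invR a b c powr Q) - (Q * \<epsilon>) * mean3 (H \<epsilon>)"
    proof (subst mean3_diff)
      show "cont3 (\<lambda>a b c. invR a b c powr Q)" "cont3 (\<lambda>a b c. (Q * \<epsilon>) * H \<epsilon> a b c)"
        using cH[of \<epsilon>] Q unfolding cont3_def by (intro cR continuous_on_mult continuous_intros; simp)+
    qed (simp only: mean3_cmult)
    finally have "(Q * \<epsilon>) * mean3 (H \<epsilon>) \<le> 0" by simp
    moreover have "0 < Q * \<epsilon>"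
      using Q \<epsilon> by simp
    ultimately show ?thesis
      by (meson mult_pos_pos not_le)
  qed
  have "(\<lambda>n. mean3 (H (inverse (real (Suc n))))) \<longlonglongrightarrow> mean3 (H 0)"
  \<comment> \<open>Here 16 is 9 + 6 + 1 and 7 is 2 * 3 + 1, from \<open>invR\<close> at most 9,
    \<open>testG\<close> at most 3 in modulus and \<open>\<epsilon>\<close> at most 1.\<close>
  proof (rule mean3_LIMSEQ[where C = "16 powr (Q - 1) * 7"])
    fix a b c :: complex assume unit: "cmod a = 1" "cmod b = 1" "cmod c = 1"
    note G = testG_bound[OF unit]
    have "(\<lambda>n. perturbed (inverse (real (Suc n))) a b c) \<longlonglongrightarrow> perturbed 0 a b c"
      unfolding perturbed_def by (intro tendsto_intros LIMSEQ_inverse_real_of_nat)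
    then show "(\<lambda>n. H (inverse (real (Suc n))) a b c) \<longlonglongrightarrow> H 0 a b c"
      unfolding H_def using Q
      by (intro tendsto_mult tendsto_diff tendsto_powr' tendsto_const LIMSEQ_inverse_real_of_nat)
        (auto simp: perturbed_nonneg)
    fix n
    have e: "0 < inverse (real (Suc n))" "inverse (real (Suc n)) \<le> 1"
      by (simp_all add: inverse_le_1_iff)
    define \<epsilon> where "\<epsilon> = inverse (real (Suc n))"
    have \<epsilon>: "0 < \<epsilon>" "\<epsilon> \<le> 1" using e by (simp_all add: \<epsilon>_def)
    have "\<bar>\<epsilon> * testG a b c\<bar> \<le> 1 * 3"
      unfolding abs_mult using \<epsilon> G by (intro mult_mono) auto
    moreover have "\<epsilon>\<^sup>2 \<le> 1"
      using \<epsilon> by (simp add: power_le_one)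
    ultimately have "perturbed \<epsilon> a b c \<le> 16"
      unfolding perturbed_eq[OF unit] using invR_le_9[OF unit] by linarith
    then have "perturbed \<epsilon> a b c powr (Q - 1) \<le> 16 powr (Q - 1)"
      using Q perturbed_nonneg by (intro powr_mono2) auto
    moreover have "\<bar>2 * testG a b c - \<epsilon>\<bar> \<le> 7"
      using G \<epsilon> by linarith
    ultimately show "norm (H (inverse (real (Suc n))) a b c) \<le> 16 powr (Q - 1) * 7"
      unfolding \<epsilon>_def[symmetric] H_def real_norm_def abs_mult by (intro mult_mono) auto
  qed (rule cH)+
  then have "mean3 (H 0) \<le> 0"
    by (rule LIMSEQ_le_const2) (auto intro!: le)
  moreover have "mean3 (H 0) = 2 * mean3 (\<lambda>a b c. invR a b c powr (Q - 1) * testG a b c)"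
    unfolding mean3_cmult[symmetric] by (rule mean3_cong) (simp add: H_def perturbed_eq)
  ultimately show False
    using mean3_testG_pos[of "Q - 1"] Q by simp
qed

text \<open>Away from the maximum of \<open>invR\<close> the crude bound on \<open>testG\<close>
  suffices, since 0.06 + 0.0001 is below 1 / 16. Near the maximum the three variables almost
  coincide and \<open>testG\<close> is at least 1, which lowers the value. The bound is the square
  of a number just below 3.\<close>

lemma perturbed_bound:
  assumes unit: "cmod a = 1" "cmod b = 1" "cmod c = 1"
  shows "perturbed (1 / 100) a b c \<le> (14999 / 5000)\<^sup>2"
proof (cases "invR a b c \<le> 9 - 1 / 16")
  case True
  then show ?thesis
    using testG_bound[OF unit] unfolding perturbed_eq[OF unit] by (simp add: power2_eq_square)
next
  case False
  have cc: "a * cnj a = 1" "b * cnj b = 1" "c * cnj c = 1"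
    using unit by (simp_all add: complex_norm_square[symmetric])
  \<comment> \<open>These are the quotients \<open>a / c\<close> and \<open>b / c\<close>, in which
    \<open>testG\<close> is the real part of \<open>x * y + x * y * x + x * y * y\<close>.\<close>
  define x y where "x = a * cnj c" and "y = b * cnj c"
  have nx: "cmod x = 1" "cmod y = 1"
    using unit by (simp_all add: x_def y_def norm_mult)
  \<comment> \<open>By this identity the defect of \<open>invR\<close> from 9 is the sum of the
    squared distances, so each distance is at most 1 / 4.\<close>
  have "(cmod (a - b))\<^sup>2 + (cmod (b - c))\<^sup>2 + (cmod (a - c))\<^sup>2 + invR a b c =
      3 * ((cmod a)\<^sup>2 + (cmod b)\<^sup>2 + (cmod c)\<^sup>2)"
    unfolding invR_def cmod_power2 by (simp add: algebra_simps power2_eq_square)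
  then have "(cmod (a - b))\<^sup>2 + (cmod (b - c))\<^sup>2 + (cmod (a - c))\<^sup>2 + invR a b c = 9"
    using unit by simp
  moreover have "(1 / 4 :: real)\<^sup>2 = 1 / 16"
    by (simp add: power2_eq_square)
  ultimately have "(cmod (b - c))\<^sup>2 \<le> (1 / 4)\<^sup>2" "(cmod (a - c))\<^sup>2 \<le> (1 / 4)\<^sup>2"
    using False zero_le_power2[of "cmod (a - b)"] zero_le_power2[of "cmod (b - c)"] zero_le_power2[of "cmod (a - c)"]
    by linarith+
  then have "cmod (b - c) \<le> 1 / 4" "cmod (a - c) \<le> 1 / 4"
    by (auto intro: power2_le_imp_le)
  moreover have "x - 1 = (a - c) * cnj c" "y - 1 = (b - c) * cnj c"
    using cc by (simp_all add: x_def y_def algebra_simps)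
  ultimately have x1: "cmod (x - 1) \<le> 1 / 4" "cmod (y - 1) \<le> 1 / 4"
    using unit by (simp_all add: norm_mult)
  \<comment> \<open>Distances from 1 add up under multiplication of unit numbers. The three products
    are thus within 1 / 2, 3 / 4 and 3 / 4 of 1, so their real parts sum to at least 1.\<close>
  have step: "cmod (u * v - 1) \<le> s + t" if "cmod (u - 1) \<le> s" "cmod (v - 1) \<le> t" "cmod v = 1" for u v s t
  proof -
    have "u * v - 1 = (u - 1) * v + (v - 1)"
      by (simp add: algebra_simps)
    then have "cmod (u * v - 1) \<le> cmod ((u - 1) * v) + cmod (v - 1)"
      by (metis norm_triangle_ineq)
    then show ?thesis
      using that by (simp add: norm_mult)
  qed
  have xy: "cmod (x * y - 1) \<le> 1 / 4 + 1 / 4"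
    using x1 nx by (intro step) auto
  have "cmod (x * y * x - 1) \<le> 1 / 4 + 1 / 4 + 1 / 4" "cmod (x * y * y - 1) \<le> 1 / 4 + 1 / 4 + 1 / 4"
    using x1 nx xy by (intro step; simp)+
  moreover have Re: "1 - cmod (u - 1) \<le> Re u" for u
    using abs_Re_le_cmod[of "u - 1"] by simp
  ultimately have "1 \<le> Re (x * y) + Re (x * y * x) + Re (x * y * y)"
    using xy Re[of "x * y"] Re[of "x * y * x"] Re[of "x * y * y"] by linarith
  also have "\<dots> = testG a b c"
  proof -
    have "(a + b + c) * (a * b * cnj c ^ 3) = x * y * (c * cnj c) + x * y * x + x * y * y"
      by (simp add: x_def y_def algebra_simps power3_eq_cube)
    then have "(a + b + c) * (a * b * cnj c ^ 3) = x * y + x * y * x + x * y * y"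
      by (simp add: cc)
    then show ?thesis
      by (simp only: testG_def plus_complex.sel)
  qed
  finally show ?thesis
    using invR_le_9[OF unit] unfolding perturbed_eq[OF unit] by (simp add: power2_eq_square)
qed

text \<open>The essential supremum of \<open>phi\<close> is 3, while subtracting one hundredth of
  the cubed third coordinate brings it down to at most \<open>14999 / 5000\<close>.\<close>

lemma not_hilbert_point_infinity: "\<not> hilbert_point \<infinity> phi"
proof
  assume hp: "hilbert_point \<infinity> phi"
  let ?f = "\<lambda>z. (- of_real (1 / 100)) * z (3::3) ^ 3"
  have "Lp_norm \<infinity> phi \<le> Lp_norm \<infinity> (\<lambda>z. phi z + ?f z)"
    using hp scaled_z3_in_Hardy torus_inner_z3_phi unfolding hilbert_point_def by blast
  also have "\<dots> \<le> 14999 / 5000"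
  proof -
    have "esssup torus (\<lambda>z. ennreal (cmod (phi z + ?f z))) \<le> ennreal (14999 / 5000)"
    proof (rule esssup_I)
      show "AE z in torus. ennreal (cmod (phi z + ?f z)) \<le> ennreal (14999 / 5000)"
      proof (intro AE_I2 ennreal_leI)
        fix z :: "3 \<Rightarrow> complex" assume z: "z \<in> space torus"
        have "(cmod (phi z + ?f z))\<^sup>2 \<le> (14999 / 5000)\<^sup>2"
          unfolding perturbed_torus[OF z, symmetric]
          using z by (intro perturbed_bound) (simp_all add: norm_mult norm_power)
        then show "cmod (phi z + ?f z) \<le> 14999 / 5000"
          by (rule power2_le_imp_le) simp
      qed
    qed measurable
    then show ?thesis
      unfolding Lp_norm_def if_P[OF refl] by (intro enn2real_leI) simp_all
  qed
  finally have "enn2real (esssup torus (\<lambda>z. ennreal (cmod (phi z)))) \<le> 14999 / 5000"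
    by (simp add: Lp_norm_def)
  moreover have "esssup torus (\<lambda>z. ennreal (cmod (phi z))) < \<infinity>"
    using phi_in_Hardy[of \<infinity>] by (simp add: Hardy_def Lp_def)
  ultimately have ess: "esssup torus (\<lambda>z. ennreal (cmod (phi z))) \<le> ennreal (14999 / 5000)"
    by (metis ennreal_enn2real ennreal_leI infinity_ennreal_def)
  have "AE z in torus. cmod (phi z) \<le> 14999 / 5000"
    using esssup_AE[of "\<lambda>z. ennreal (cmod (phi z))" torus]
  proof eventually_elim
    case (elim z)
    then have "ennreal (cmod (phi z)) \<le> ennreal (14999 / 5000)"
      using ess by (rule order_trans)
    then show ?case by simp
  qed
  from AE_cmod_phi_imp_3_le[OF this] show False by simp
qed

theorem theorem6p2:
  shows "hilbert_point 2 phi \<and> hilbert_point 4 phi \<and>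
    (\<forall>p::ennreal. 4 < p \<and> p \<le> \<infinity> \<longrightarrow> \<not> hilbert_point p phi)"
proof (intro conjI allI impI)
  show "hilbert_point 2 phi" by (rule hilbert_point_2_phi)
  show "hilbert_point 4 phi" by (rule hilbert_point_4_phi)
  fix p :: ennreal assume p: "4 < p \<and> p \<le> \<infinity>"
  show "\<not> hilbert_point p phi"
  proof (cases p)
    case (real q)
    have "ennreal 4 < ennreal q"
      using p real by simp
    then have "4 < q"
      by (simp add: ennreal_less_iff)
    then show ?thesis
      unfolding real by (rule not_hilbert_point_finite)
  next
    case top
    then show ?thesis
      using not_hilbert_point_infinity by simp
  qed
qed

end
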